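(* Let $d\ge1$, $\sigma\geq 0$, let $(\mu_k)_{k\in\mathbb{N}}\subset\mathcal{P}_1(\mathbb{R}^d)$ be a sequence and let $\mu\in\mathcal{P}_1(\mathbb{R}^d)$. Then $\mathsf{W}_1^{(\sigma)}(\mu_k,\mu)\to 0$ as $k\to\infty$ if and only if $\int\|x\|\,d\mu_k(x)\to\int\|x\|\,d\mu(x)$ and $\mu_k\rightharpoonup\mu$. Consequently, $\mathsf{W}_1^{(\sigma)}(\mu_k,\mu)\to 0$ if and only if $\mathsf{W}_1(\mu_k,\mu)\to 0$.
   Context: $\mathcal{P}(\mathbb{R}^d)$ is the set of Borel probability measures on $\mathbb{R}^d$, and $\mathcal{P}_1(\mathbb{R}^d)\subset\mathcal{P}(\mathbb{R}^d)$ consists of those with finite first moment, $\int\|x\|\,d\mu(x)<\infty$, where $\|\cdot\|$ is the Euclidean norm. Weak convergence $\mu_k\rightharpoonup\mu$ means $\int f\,d\mu_k\to\int f\,d\mu$ for every bounded continuous $f:\mathbb{R}^d\to\mathbb{R}$. $\Pi(\mu,\nu)$ is the set of couplings of $\mu$ and $\nu$ (probability measures on $\mathbb{R}^d\times\mathbb{R}^d$ with marginals $\mu$ and $\nu$), and $\mathsf{W}_1(\mu,\nu)=\inf_{\pi\in\Pi(\mu,\nu)}\int\|x-y\|\,d\pi(x,y)$. For $\sigma\ge0$, $\mathcal{N}_\sigma=\mathcal{N}(0,\sigma^2 \mathrm{I}_d)$ is the isotropic Gaussian measure on $\mathbb{R}^d$ (with $\mathcal{N}_0=\delta_0$), $\ast$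 is convolution of measures, and $\mathsf{W}_1^{(\sigma)}(\mu,\nu)=\mathsf{W}_1(\mu\ast\mathcal{N}_\sigma,\nu\ast\mathcal{N}_\sigma)$. *)

theory Defs
  imports "HOL-Probability.Probability"
begin

definition borel_prob_measures :: "(real ^ 'n) measure set" where
  "borel_prob_measures = {\<mu>. prob_space \<mu> \<and> sets \<mu> = sets borel}"

definition borel_prob_measures1 :: "(real ^ 'n) measure set" where
  "borel_prob_measures1 = {\<mu> \<in> borel_prob_measures. integrable \<mu> (\<lambda>x. norm x)}"

text \<open>The library's \<open>weak_conv_m\<close> is phrased through distribution functions and is
  available on the real line only.\<close>

definition weakly_converges :: "(nat \<Rightarrow> (real ^ 'n) measure) \<Rightarrow> (real ^ 'n) measure \<Rightarrow> bool" where
  "weakly_converges \<mu>s \<mu> \<longleftrightarrow>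
     (\<forall>f :: (real ^ 'n) \<Rightarrow> real. continuous_on UNIV f \<longrightarrow> bounded (range f) \<longrightarrow>
        (\<lambda>k. \<integral>x. f x \<partial>\<mu>s k) \<longlonglongrightarrow> (\<integral>x. f x \<partial>\<mu>))"

definition couplings ::
  "(real ^ 'n) measure \<Rightarrow> (real ^ 'n) measure \<Rightarrow> ((real ^ 'n) \<times> (real ^ 'n)) measure set" where
  "couplings \<mu> \<nu> =
     {\<pi>. prob_space \<pi> \<and> sets \<pi> = sets borel \<and> distr \<pi> borel fst = \<mu> \<and> distr \<pi> borel snd = \<nu>}"

text \<open>Transport cost and distance take values in \<^typ>\<open>ennreal\<close>, so that a
  non-integrable cost has value \<open>\<infinity>\<close> instead of the Bochner default \<open>0\<close>.\<close>

definition W1 :: "(real ^ 'n) measure \<Rightarrow> (real ^ 'n) measure \<Rightarrow> ennreal" where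
  "W1 \<mu> \<nu> = (INF \<pi>\<in>couplings \<mu> \<nu>. \<integral>\<^sup>+(x, y). ennreal (norm (x - y)) \<partial>\<pi>)"

definition gaussian :: "real \<Rightarrow> (real ^ 'n) measure" where
  "gaussian \<sigma> =
     (if \<sigma> = 0 then return borel 0
      else density lborel (\<lambda>x :: real ^ 'n.
        ennreal (1 / sqrt (2 * pi * \<sigma>\<^sup>2) ^ CARD('n) * exp (- (norm x)\<^sup>2 / (2 * \<sigma>\<^sup>2)))))"

definition smoothed_W1 :: "real \<Rightarrow> (real ^ 'n) measure \<Rightarrow> (real ^ 'n) measure \<Rightarrow> ennreal" where
  "smoothed_W1 \<sigma> \<mu> \<nu> = W1 (\<mu> \<star> gaussian \<sigma>) (\<nu> \<star> gaussian \<sigma>)"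

end

theory Submission
  imports Defs
begin

text \<open>
  The theorem follows once, for every \<open>\<sigma> \<ge> 0\<close>, convergence to zero of the smoothed distance is shown
  to be equivalent to weak convergence together with convergence of the first moments: that
  condition does not mention \<open>\<sigma>\<close>, and \<open>\<sigma> = 0\<close> gives the unsmoothed distance back
  (\<open>smoothed_W1_0\<close>).

  From smoothed distance to weak convergence. A Lipschitz function has nearly the same integral
  under two measures that are close in transport distance (\<open>W1_tendsto_integral_lipschitz\<close>).
  Characters \<open>x \<mapsto> exp (i t \<bullet> x)\<close> are Lipschitz, so the characteristic functions of the smoothed
  measures converge; the one of the Gaussian never vanishes and can be divided out
  (\<open>characteristic_tendsto\<close>). The way back from characteristic functions to measures goes
  through densities. The density of \<open>\<mu>\<^sub>k \<star> N\<^sub>\<epsilon>\<close> at a point is an integral of the characteristic function of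
  \<open>\<mu>\<^sub>k\<close> against a Gaussian, because Gaussians are Fourier transforms of Gaussians. Hence these
  densities converge pointwise, and by Scheffe's lemma in \<open>L\<^sup>1\<close>. A bounded Lipschitz function changes
  its integral by \<open>O(\<epsilon>)\<close> under smoothing with \<open>N\<^sub>\<epsilon>\<close>, so its integrals against \<open>\<mu>\<^sub>k\<close> converge, and a
  bounded continuous function is a pointwise limit from below of bounded Lipschitz ones.

  The moments. The norm is Lipschitz, so the first moments of the smoothed measures converge. The
  moment of \<open>\<mu>\<^sub>k \<star> N\<^sub>\<sigma>\<close> exceeds that of \<open>\<mu>\<^sub>k\<close> by the integral of \<open>h x = E |x + Z| - |x|\<close>, which is
  bounded and continuous, so weak convergence removes the difference.

  From weak convergence and moments to distance. Adding the same independent noise to both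
  coordinates of a coupling shows that smoothing does not increase the distance
  (\<open>smoothed_W1_le_W1\<close>), so it suffices to treat \<open>\<sigma> = 0\<close>. For this an explicit coupling
  is written down (\<open>W1_le_local_coupling\<close>): with a finite partition of unity by bumps \<open>\<phi>\<^sub>j\<close> of small
  support, as much mass as possible is coupled inside each bump, in amount
  \<open>min (\<integral> \<phi>\<^sub>j d\<mu>\<^sub>k) (\<integral> \<phi>\<^sub>j d\<mu>)\<close>, and the remaining mass is coupled independently. The first part is moved
  by at most the diameter of the supports. The remaining mass costs at most the first moments that
  it carries, and in the limit these reduce to the tail of the first moment of \<open>\<mu>\<close> outside a large
  ball.
\<close>

section \<open>Borel probability measures with finite first moment\<close>

lemma borel_prob_measuresD:
  assumes "\<mu> \<in> borel_prob_measures"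
  shows "prob_space \<mu>" "sets \<mu> = sets borel" "space \<mu> = UNIV"
  using assms sets_eq_imp_space_eq[of \<mu> borel] by (auto simp: borel_prob_measures_def)

lemma borel_prob_measures1D:
  assumes "\<mu> \<in> borel_prob_measures1"
  shows "\<mu> \<in> borel_prob_measures" "integrable \<mu> norm"
  using assms by (auto simp: borel_prob_measures1_def)

lemma integrable_bounded_borel:
  fixes f :: "real ^ 'n \<Rightarrow> 'b :: {banach, second_countable_topology}"
  assumes "M \<in> borel_prob_measures" and f: "f \<in> borel_measurable borel" and "\<And>x. norm (f x) \<le> B"
  shows "integrable M f"
proof -
  note M = borel_prob_measuresD[OF assms(1)]
  interpret prob_space M by fact
  show ?thesis using f assms(3)
    by (intro integrable_const_bound[where B=B]) (auto simp: measurable_cong_sets[OF M(2) refl])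
qed

text \<open>A non-integrable function has integral \<open>0\<close>, and \<open>B\<close> is nonnegative because it bounds a norm.\<close>

lemma (in prob_space) norm_integral_le_bound:
  fixes f :: "'a \<Rightarrow> 'b :: {banach, second_countable_topology}"
  assumes "\<And>x. norm (f x) \<le> B"
  shows "norm (\<integral>x. f x \<partial>M) \<le> B"
proof (cases "integrable M f")
  case True
  then have "(\<integral>x. norm (f x) \<partial>M) \<le> (\<integral>x. B \<partial>M)"
    using assms by (intro integral_mono) auto
  with integral_norm_bound[of M f] have "norm (\<integral>x. f x \<partial>M) \<le> (\<integral>x. B \<partial>M)"
    by (rule order_trans)
  then show ?thesis by (simp add: prob_space)
next
  case False
  then show ?thesis using order_trans[OF norm_ge_zero assms] by (simp add: not_integrable_integral_eq)
qed

lemma nn_integral_norm_finite: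
  assumes "integrable M (norm :: real ^ 'n \<Rightarrow> real)"
  shows "(\<integral>\<^sup>+x. norm x \<partial>M) < \<infinity>"
  using assms by (simp add: nn_integral_eq_integral)

section \<open>The isotropic Gaussian measure\<close>

definition gaussian_density :: "real \<Rightarrow> real ^ 'n \<Rightarrow> real" where
  "gaussian_density \<sigma> x =
     1 / sqrt (2 * pi * \<sigma>\<^sup>2) ^ CARD('n) * exp (- (norm x)\<^sup>2 / (2 * \<sigma>\<^sup>2))"

lemma gaussian_density_nonneg [simp]: "0 \<le> gaussian_density \<sigma> x"
  by (simp add: gaussian_density_def)

lemma borel_measurable_gaussian_density [measurable]:
  "gaussian_density \<sigma> \<in> borel_measurable borel"
  unfolding gaussian_density_def[abs_def] by measurable

lemma gaussian_eq_density:
  "\<sigma> \<noteq> 0 \<Longrightarrow> gaussian \<sigma> = density lborel (\<lambda>x. ennreal (gaussian_density \<sigma> x))"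
  by (simp add: gaussian_def gaussian_density_def)

lemma sets_gaussian [simp, measurable_cong]: "sets (gaussian \<sigma>) = sets borel"
  by (simp add: gaussian_def)

text \<open>The density factors over the coordinates, which reduces all Gaussian integrals below to the line.\<close>

lemma gaussian_density_eq_prod:
  fixes x :: "real ^ 'n"
  shows "gaussian_density \<sigma> x = (\<Prod>b\<in>Basis. normal_density 0 \<sigma> (x \<bullet> b))"
proof -
  have "(\<Prod>b\<in>Basis. normal_density 0 \<sigma> (x \<bullet> b)) =
      (1 / sqrt (2 * pi * \<sigma>\<^sup>2)) ^ DIM(real ^ 'n) * (\<Prod>b\<in>Basis. exp (- (x \<bullet> b)\<^sup>2 / (2 * \<sigma>\<^sup>2)))"
    unfolding normal_density_def prod.distrib by simp
  also have "(\<Prod>b\<in>Basis. exp (- (x \<bullet> b)\<^sup>2 / (2 * \<sigma>\<^sup>2))) = exp (\<Sum>b\<in>Basis. - (x \<bullet> b)\<^sup>2 / (2 * \<sigma>\<^sup>2))"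
    by (simp add: exp_sum)
  also have "(\<Sum>b\<in>Basis. - (x \<bullet> b)\<^sup>2 / (2 * \<sigma>\<^sup>2)) = - (norm x)\<^sup>2 / (2 * \<sigma>\<^sup>2)"
    unfolding sum_divide_distrib[symmetric] sum_negf power2_norm_eq_inner
    by (subst euclidean_inner) (simp add: power2_eq_square)
  finally show ?thesis by (simp add: gaussian_density_def power_divide)
qed

lemma integral_iexp_normal_density:
  assumes "\<sigma> > 0"
  shows "(\<integral>x. normal_density 0 \<sigma> x *\<^sub>R iexp (t * x) \<partial>lborel) = exp (- (\<sigma> * t)\<^sup>2 / 2)"
proof -
  have nd: "\<sigma> * normal_density 0 \<sigma> (\<sigma> * x) = std_normal_density x" for x
    using assms by (simp add: normal_density_def real_sqrt_mult field_simps power2_eq_square)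
  have "(\<integral>x. normal_density 0 \<sigma> x *\<^sub>R iexp (t * x) \<partial>lborel) =
      \<bar>\<sigma>\<bar> *\<^sub>R (\<integral>x. normal_density 0 \<sigma> (0 + \<sigma> * x) *\<^sub>R iexp (t * (0 + \<sigma> * x)) \<partial>lborel)"
    using assms by (intro lborel_integral_real_affine) auto
  also have "\<dots> = (\<integral>x. std_normal_density x *\<^sub>R iexp (\<sigma> * t * x) \<partial>lborel)"
    using assms unfolding nd[symmetric]
    by (subst integral_scaleR_right[symmetric]) (simp add: mult_ac)
  also have "\<dots> = char std_normal_distribution (\<sigma> * t)"
    unfolding char_def by (subst integral_density) auto
  finally show ?thesis by (simp add: char_std_normal_distribution)
qed

text \<open>Lebesgue measure is the image of the product measure over the coordinates, and both the density
  and the character \<open>exp (i t \<bullet> x)\<close> are products of functions of one coordinate. The case \<open>t = 0\<close>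
  also normalizes the density.\<close>

lemma iexp_gaussian_density:
  fixes t :: "real ^ 'n"
  assumes "\<sigma> > 0"
  shows "has_bochner_integral lborel (\<lambda>x. gaussian_density \<sigma> x *\<^sub>R iexp (t \<bullet> x))
    (exp (- (\<sigma> * norm t)\<^sup>2 / 2))"
proof -
  let ?P = "\<Pi>\<^sub>M b\<in>(Basis :: (real ^ 'n) set). (lborel :: real measure)"
  let ?s = "\<lambda>f :: (real ^ 'n) \<Rightarrow> real. \<Sum>b\<in>Basis. f b *\<^sub>R b"
  let ?g = "\<lambda>b x. normal_density 0 \<sigma> x *\<^sub>R iexp ((t \<bullet> b) * x)"
  interpret product_sigma_finite "\<lambda>_ :: real ^ 'n. lborel :: real measure" ..
  have int: "integrable lborel (?g b)" for b
    by (rule Bochner_Integration.integrable_bound[OF integrable_normal_density[OF assms, of 0]]) auto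
  have fac: "gaussian_density \<sigma> (?s f) *\<^sub>R iexp (t \<bullet> ?s f) = (\<Prod>b\<in>Basis. ?g b (f b))" for f
  proof -
    have inn: "(\<Sum>c\<in>Basis. f c *\<^sub>R c) \<bullet> b = f b" if "b \<in> Basis" for b
      using that by (simp add: inner_sum_left inner_Basis if_distrib[of "\<lambda>x. _ * x"] cong: if_cong)
    have "iexp (t \<bullet> ?s f) = (\<Prod>b\<in>Basis. iexp ((t \<bullet> b) * f b))"
      by (simp add: inner_sum_right exp_sum[symmetric] sum_distrib_left mult_ac)
    then show ?thesis
      unfolding gaussian_density_eq_prod scaleR_conv_of_real[where 'a=complex] prod.distrib of_real_prod
      by (simp add: inn)
  qed
  have "has_bochner_integral ?P (\<lambda>f. \<Prod>b\<in>Basis. ?g b (f b)) (\<Prod>b\<in>Basis. integral\<^sup>L lborel (?g b))"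
    unfolding has_bochner_integral_iff
    using product_integral_prod[of Basis ?g] product_integrable_prod[of Basis ?g] int by simp
  also have "(\<Prod>b\<in>Basis. integral\<^sup>L lborel (?g b)) = (\<Prod>b\<in>Basis. exp (- (\<sigma> * (t \<bullet> b))\<^sup>2 / 2))"
    by (simp only: integral_iexp_normal_density[OF assms] of_real_prod)
  also have "(\<Prod>b\<in>Basis. exp (- (\<sigma> * (t \<bullet> b))\<^sup>2 / 2)) = exp (- (\<sigma> * norm t)\<^sup>2 / 2)"
  proof -
    have "(\<Sum>b\<in>Basis. - (\<sigma> * (t \<bullet> b))\<^sup>2 / 2) = - (\<sigma> * norm t)\<^sup>2 / 2"
      unfolding sum_divide_distrib[symmetric] sum_negf power_mult_distrib
        sum_distrib_left[symmetric] power2_norm_eq_inner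
      by (subst euclidean_inner[of t t]) (simp add: power2_eq_square)
    then show ?thesis by (simp add: exp_sum[symmetric])
  qed
  finally have "has_bochner_integral ?P (\<lambda>f. gaussian_density \<sigma> (?s f) *\<^sub>R iexp (t \<bullet> ?s f))
      (exp (- (\<sigma> * norm t)\<^sup>2 / 2))"
    unfolding fac .
  then have "has_bochner_integral (distr ?P borel ?s) (\<lambda>x. gaussian_density \<sigma> x *\<^sub>R iexp (t \<bullet> x))
      (exp (- (\<sigma> * norm t)\<^sup>2 / 2))"
    by (intro has_bochner_integral_distr) auto
  then show ?thesis
    by (subst lborel_eq)
qed

lemma gaussian_density_integral:
  assumes "\<sigma> > 0"
  shows "has_bochner_integral lborel (gaussian_density \<sigma> :: real ^ 'n \<Rightarrow> real) 1"
proof -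
  have "has_bochner_integral lborel (\<lambda>x :: real ^ 'n. complex_of_real (gaussian_density \<sigma> x)) (of_real 1)"
    using iexp_gaussian_density[OF assms, of 0] by (simp add: scaleR_conv_of_real)
  then show ?thesis
    unfolding has_bochner_integral_iff by (simp add: complex_of_real_integrable_eq)
qed

lemma gaussian_density_le:
  "gaussian_density \<epsilon> (x :: real ^ 'n) \<le> 1 / sqrt (2 * pi * \<epsilon>\<^sup>2) ^ CARD('n)"
proof -
  have "1 / sqrt (2 * pi * \<epsilon>\<^sup>2) ^ CARD('n) * exp (- (norm x)\<^sup>2 / (2 * \<epsilon>\<^sup>2))
      \<le> 1 / sqrt (2 * pi * \<epsilon>\<^sup>2) ^ CARD('n) * 1"
    by (intro mult_left_mono) auto
  then show ?thesis by (simp add: gaussian_density_def)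
qed

lemma prob_space_gaussian: "prob_space (gaussian \<sigma> :: (real ^ 'n) measure)"
proof (cases "\<sigma> = 0")
  case True
  then show ?thesis by (simp add: gaussian_def prob_space_return)
next
  case False
  have abs: "gaussian_density \<bar>\<sigma>\<bar> = (gaussian_density \<sigma> :: real ^ 'n \<Rightarrow> real)"
    by (simp add: gaussian_density_def fun_eq_iff)
  have "has_bochner_integral lborel (gaussian_density \<sigma> :: real ^ 'n \<Rightarrow> real) 1"
    using gaussian_density_integral[of "\<bar>\<sigma>\<bar>", where 'n='n] False unfolding abs by simp
  then have "(\<integral>\<^sup>+x. ennreal (gaussian_density \<sigma> (x :: real ^ 'n)) \<partial>lborel) = 1"
    by (subst nn_integral_eq_integral) (auto simp: has_bochner_integral_iff)
  then show ?thesis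
    using False by (intro prob_spaceI) (simp add: gaussian_eq_density emeasure_density)
qed

lemma gaussian_in_borel_prob_measures: "gaussian \<sigma> \<in> borel_prob_measures"
  by (simp add: borel_prob_measures_def prob_space_gaussian)

lemma integral_iexp_gaussian:
  fixes t :: "real ^ 'n"
  assumes "\<sigma> \<ge> 0"
  shows "(\<integral>x. iexp (t \<bullet> x) \<partial>gaussian \<sigma>) = exp (- (\<sigma> * norm t)\<^sup>2 / 2)"
proof (cases "\<sigma> = 0")
  case True
  then show ?thesis by (simp add: gaussian_def integral_return)
next
  case False
  then have "\<sigma> > 0" using assms by simp
  then show ?thesis
    using iexp_gaussian_density[of \<sigma> t] 
    by (simp add: gaussian_eq_density integral_density has_bochner_integral_iff)
qed

text \<open>With \<open>u = |x| / \<sigma>\<close>, the inequality \<open>u \<le> exp (u\<^sup>2 / 4)\<close> absorbs the factor \<open>|x|\<close> into a Gaussian of twice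
  the variance, whose total mass is known. What matters later is only that the bound is
  finite and linear in \<open>\<sigma>\<close>.\<close>

lemma gaussian_first_moment:
  assumes "\<sigma> \<ge> 0"
  shows "integrable (gaussian \<sigma> :: (real ^ 'n) measure) norm" (is ?I)
    and "(\<integral>x. norm x \<partial>(gaussian \<sigma> :: (real ^ 'n) measure)) \<le> \<sigma> * sqrt 2 ^ CARD('n)" (is ?B)
proof -
  have "?I \<and> ?B"
  proof (cases "\<sigma> = 0")
    case True
    have "integrable (return borel (0 :: real ^ 'n)) norm"
      by (rule integrableI_bounded) (auto simp: nn_integral_return)
    with True show ?thesis by (simp add: gaussian_def integral_return)
  next
    case False
    then have s: "\<sigma> > 0" using assms by simp
    have le: "norm (gaussian_density \<sigma> x * norm x) \<le> \<sigma> * sqrt 2 ^ CARD('n) * gaussian_density (sqrt 2 * \<sigma>) x"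
      for x :: "real ^ 'n"
    proof -
      define u where "u = norm x / \<sigma>"
      have x: "norm x = \<sigma> * u" using s by (simp add: u_def)
      have u_nonneg: "0 \<le> u" using s by (simp add: u_def)
      have "0 \<le> (u/2 - 1)\<^sup>2" by simp
      then have "u \<le> 1 + u\<^sup>2 / 4" by (simp add: power2_eq_square algebra_simps)
      also have "\<dots> \<le> exp (u\<^sup>2 / 4)" by (rule exp_ge_add_one_self)
      finally have "u * exp (- u\<^sup>2 / 2) \<le> exp (u\<^sup>2 / 4) * exp (- u\<^sup>2 / 2)"
        by (rule mult_right_mono) simp
      also have "\<dots> = exp (- u\<^sup>2 / 4)" by (simp flip: exp_add)
      finally have *: "u * exp (- u\<^sup>2 / 2) \<le> exp (- u\<^sup>2 / 4)" .
      have "u\<^sup>2 = (norm x)\<^sup>2 / \<sigma>\<^sup>2" by (simp add: u_def power_divide)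
      then have e1: "- (norm x)\<^sup>2 / (2 * \<sigma>\<^sup>2) = - u\<^sup>2 / 2" "- (norm x)\<^sup>2 / (2 * (sqrt 2 * \<sigma>)\<^sup>2) = - u\<^sup>2 / 4"
        using s by (simp_all add: power_mult_distrib)
      have e2: "sqrt 2 ^ CARD('n) * (1 / sqrt (2 * pi * (sqrt 2 * \<sigma>)\<^sup>2) ^ CARD('n)) = 1 / sqrt (2 * pi * \<sigma>\<^sup>2) ^ CARD('n)"
      proof -
        have "sqrt (2 * pi * (sqrt 2 * \<sigma>)\<^sup>2) = sqrt 2 * sqrt (2 * pi * \<sigma>\<^sup>2)"
          by (simp add: power_mult_distrib real_sqrt_mult)
        then show ?thesis by (simp only: power_mult_distrib) simp
      qed
      have "norm (gaussian_density \<sigma> x * norm x) = \<sigma> * (1 / sqrt (2 * pi * \<sigma>\<^sup>2) ^ CARD('n)) * (u * exp (- u\<^sup>2 / 2))"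
        unfolding gaussian_density_def e1(1) using s by (simp add: abs_mult x u_nonneg)
      also have "\<dots> \<le> \<sigma> * (1 / sqrt (2 * pi * \<sigma>\<^sup>2) ^ CARD('n)) * exp (- u\<^sup>2 / 4)"
        using s * by (intro mult_left_mono) auto
      also have "\<dots> = \<sigma> * sqrt 2 ^ CARD('n) * gaussian_density (sqrt 2 * \<sigma>) x"
        unfolding gaussian_density_def e1 e2[symmetric] by (simp add: mult_ac)
      finally show ?thesis .
    qed
    have "sqrt 2 * \<sigma> > 0" using s by simp
    note G = gaussian_density_integral[OF this, where 'n='n, unfolded has_bochner_integral_iff]
    have Gc: "integrable lborel (\<lambda>x :: real ^ 'n. \<sigma> * sqrt 2 ^ CARD('n) * gaussian_density (sqrt 2 * \<sigma>) x)"
      using G by (intro integrable_mult_right) auto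
    have I: "integrable lborel (\<lambda>x :: real ^ 'n. gaussian_density \<sigma> x * norm x)"
      using le s by (intro Bochner_Integration.integrable_bound[OF Gc]) (auto simp: abs_mult)
    have "(\<integral>x. gaussian_density \<sigma> x * norm x \<partial>(lborel :: (real ^ 'n) measure))
        \<le> (\<integral>x. \<sigma> * sqrt 2 ^ CARD('n) * gaussian_density (sqrt 2 * \<sigma>) x \<partial>(lborel :: (real ^ 'n) measure))"
      using le by (intro integral_mono[OF I Gc]) (auto simp: abs_mult)
    also have "\<dots> = \<sigma> * sqrt 2 ^ CARD('n)" using G by simp
    finally show ?thesis
      using s I by (simp add: gaussian_eq_density integral_density integrable_density)
  qed
  then show ?I ?B by auto
qed

lemma gaussian_in_borel_prob_measures1: "\<sigma> \<ge> 0 \<Longrightarrow> (gaussian \<sigma> :: (real ^ 'n) measure) \<in> borel_prob_measures1"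
  by (simp add: borel_prob_measures1_def gaussian_in_borel_prob_measures gaussian_first_moment)

section \<open>Convolution\<close>

lemma integral_convolution:
  fixes f :: "real ^ 'n \<Rightarrow> 'b :: {banach, second_countable_topology}"
  assumes "M \<in> borel_prob_measures" "N \<in> borel_prob_measures" and f: "integrable (M \<star> N) f"
  shows "(\<integral>x. f x \<partial>(M \<star> N)) = (\<integral>x. (\<integral>y. f (x + y) \<partial>N) \<partial>M)"
proof -
  note M = borel_prob_measuresD[OF assms(1)] and N = borel_prob_measuresD[OF assms(2)]
  note [measurable_cong] = M(2) N(2)
  interpret M: prob_space M by fact
  interpret N: prob_space N by fact
  interpret P: pair_sigma_finite M N ..
  have [measurable]: "f \<in> borel_measurable borel"
    using borel_measurable_integrable[OF f] by simp
  have "integrable (M \<Otimes>\<^sub>M N) (\<lambda>p. f (case p of (x, y) \<Rightarrow> x + y))"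
    using f unfolding convolution_def by (subst (asm) integrable_distr_eq) auto
  then have i: "integrable (M \<Otimes>\<^sub>M N) (\<lambda>(x, y). f (x + y))" by (simp add: split_beta')
  have "(\<integral>x. f x \<partial>(M \<star> N)) = (\<integral>p. (\<lambda>(x, y). f (x + y)) p \<partial>(M \<Otimes>\<^sub>M N))"
    unfolding convolution_def by (subst integral_distr) (auto simp: split_beta')
  also have "\<dots> = (\<integral>x. (\<integral>y. f (x + y) \<partial>N) \<partial>M)"
    using P.integral_fst[OF i] by simp
  finally show ?thesis .
qed

lemma convolution_in_borel_prob_measures:
  assumes "M \<in> borel_prob_measures" "N \<in> borel_prob_measures"
  shows "(M \<star> N) \<in> borel_prob_measures"
proof -
  note M = borel_prob_measuresD[OF assms(1)] and N = borel_prob_measuresD[OF assms(2)]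
  note [measurable_cong] = M(2) N(2)
  interpret pair_prob_space M N
    using M N by (simp add: pair_prob_space_def pair_sigma_finite_def prob_space_imp_sigma_finite)
  show ?thesis
    unfolding borel_prob_measures_def convolution_def by (auto intro!: prob_space_distr)
qed

lemma convolution_in_borel_prob_measures1:
  assumes "M \<in> borel_prob_measures1" "N \<in> borel_prob_measures1"
  shows "(M \<star> N) \<in> borel_prob_measures1"
proof -
  note M1 = borel_prob_measures1D[OF assms(1)] and N1 = borel_prob_measures1D[OF assms(2)]
  note M = borel_prob_measuresD[OF M1(1)] and N = borel_prob_measuresD[OF N1(1)]
  note [measurable_cong] = M(2) N(2)
  interpret M: prob_space M by fact
  interpret N: prob_space N by fact
  have "(\<integral>\<^sup>+x. norm x \<partial>(M \<star> N)) = (\<integral>\<^sup>+x. \<integral>\<^sup>+y. norm (x + y) \<partial>N \<partial>M)"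
    by (intro nn_integral_convolution M.finite_measure N.finite_measure M N) auto
  also have "\<dots> \<le> (\<integral>\<^sup>+x. \<integral>\<^sup>+y. ennreal (norm x) + ennreal (norm y) \<partial>N \<partial>M)"
    by (intro nn_integral_mono) (auto simp: norm_triangle_ineq simp flip: ennreal_plus)
  also have "\<dots> = (\<integral>\<^sup>+x. norm x \<partial>M) + (\<integral>\<^sup>+y. norm y \<partial>N)"
    by (simp add: nn_integral_add M.emeasure_space_1 N.emeasure_space_1)
  also have "\<dots> < \<infinity>"
    using nn_integral_norm_finite[OF M1(2)] nn_integral_norm_finite[OF N1(2)] by simp
  finally have "integrable (M \<star> N) norm"
    by (intro integrableI_bounded) auto
  then show ?thesis
    using convolution_in_borel_prob_measures[OF M1(1) N1(1)] by (simp add: borel_prob_measures1_def)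
qed

text \<open>Translation invariance of Lebesgue measure followed by Tonelli.\<close>

lemma convolution_density_right:
  fixes h :: "real ^ 'n \<Rightarrow> ennreal"
  assumes "M \<in> borel_prob_measures" and [measurable]: "h \<in> borel_measurable borel"
    and "finite_measure (density lborel h)"
  shows "(M \<star> density lborel h) = density lborel (\<lambda>y. \<integral>\<^sup>+x. h (y - x) \<partial>M)"
proof (rule measure_eqI)
  note M = borel_prob_measuresD[OF assms(1)]
  note [measurable_cong] = M(2)
  interpret M: prob_space M by fact
  interpret P: pair_sigma_finite M "lborel :: (real ^ 'n) measure" ..
  fix A :: "(real ^ 'n) set" assume "A \<in> sets (M \<star> density lborel h)"
  then have [measurable]: "A \<in> sets borel" by simp
  have tr: "(\<integral>\<^sup>+z. h z * indicator A (x + z) \<partial>lborel) = (\<integral>\<^sup>+y. h (y - x) * indicator A y \<partial>lborel)" for x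
  proof -
    have "(\<integral>\<^sup>+y. h (y - x) * indicator A y \<partial>lborel) =
        (\<integral>\<^sup>+y. h (y - x) * indicator A y \<partial>(distr lborel borel ((+) x)))"
      by (simp add: lborel_distr_plus)
    then show ?thesis by (simp add: nn_integral_distr)
  qed
  have "emeasure (M \<star> density lborel h) A = (\<integral>\<^sup>+x. \<integral>\<^sup>+z. indicator A (x + z) \<partial>density lborel h \<partial>M)"
    using assms M by (intro convolution_emeasure') (auto simp: M.finite_measure_axioms)
  also have "\<dots> = (\<integral>\<^sup>+x. \<integral>\<^sup>+y. h (y - x) * indicator A y \<partial>lborel \<partial>M)"
    by (simp add: nn_integral_density tr)
  also have "\<dots> = (\<integral>\<^sup>+y. \<integral>\<^sup>+x. h (y - x) * indicator A y \<partial>M \<partial>lborel)"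
    by (rule P.Fubini'[symmetric]) measurable
  also have "\<dots> = emeasure (density lborel (\<lambda>y. \<integral>\<^sup>+x. h (y - x) \<partial>M)) A"
    by (simp add: emeasure_density nn_integral_multc)
  finally show "emeasure (M \<star> density lborel h) A = emeasure (density lborel (\<lambda>y. \<integral>\<^sup>+x. h (y - x) \<partial>M)) A" .
qed simp

lemma convolution_gaussian_eq_density:
  fixes M :: "(real ^ 'n) measure"
  assumes M: "M \<in> borel_prob_measures" and "\<epsilon> > 0"
  shows "(M \<star> gaussian \<epsilon>) = density lborel (\<lambda>y. ennreal (\<integral>x. gaussian_density \<epsilon> (y - x) \<partial>M))"
proof -
  have e: "gaussian \<epsilon> = density lborel (\<lambda>x :: real ^ 'n. ennreal (gaussian_density \<epsilon> x))"
    using assms by (simp add: gaussian_eq_density)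
  interpret G: prob_space "gaussian \<epsilon> :: (real ^ 'n) measure" by (rule prob_space_gaussian)
  have "(\<integral>\<^sup>+x. ennreal (gaussian_density \<epsilon> (y - x)) \<partial>M) = ennreal (\<integral>x. gaussian_density \<epsilon> (y - x) \<partial>M)" for y
    using gaussian_density_le
    by (intro nn_integral_eq_integral integrable_bounded_borel[OF M]) auto
  then show ?thesis
    unfolding e using M G.finite_measure_axioms[unfolded e] by (subst convolution_density_right) auto
qed

section \<open>Transport distance and Lipschitz functions\<close>

lemma couplingsD:
  assumes "\<pi> \<in> couplings \<mu> \<nu>"
  shows "prob_space \<pi>" "sets \<pi> = sets borel" "distr \<pi> borel fst = \<mu>" "distr \<pi> borel snd = \<nu>"
  using assms by (auto simp: couplings_def)

text \<open>The easy half of Kantorovich duality: under any coupling, the difference of the two integrals is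
  the integral of \<open>f x - f y\<close>. Values in a Banach space are allowed so that complex characters
  are covered.\<close>

lemma integral_diff_le_W1:
  fixes f :: "real ^ 'n \<Rightarrow> 'b :: {banach, second_countable_topology}"
  assumes int: "integrable \<mu> f" "integrable \<nu> f"
    and [measurable]: "f \<in> borel_measurable borel"
    and lip: "\<And>x y. norm (f x - f y) \<le> norm (x - y)"
  shows "ennreal (norm ((\<integral>x. f x \<partial>\<mu>) - (\<integral>x. f x \<partial>\<nu>))) \<le> W1 \<mu> \<nu>"
  unfolding W1_def
proof (rule INF_greatest)
  fix \<pi> assume "\<pi> \<in> couplings \<mu> \<nu>"
  note \<pi> = couplingsD[OF this]
  note [measurable_cong] = \<pi>(2)
  have sb: "sets \<pi> = sets (borel \<Otimes>\<^sub>M borel)" unfolding \<pi>(2) borel_prod ..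
  have [measurable]: "fst \<in> \<pi> \<rightarrow>\<^sub>M borel" "snd \<in> \<pi> \<rightarrow>\<^sub>M borel"
    by (simp_all add: measurable_cong_sets[OF sb refl])
  have i1: "integrable \<pi> (\<lambda>p. f (fst p))"
    using int(1) unfolding \<pi>(3)[symmetric] by (subst (asm) integrable_distr_eq) auto
  have i2: "integrable \<pi> (\<lambda>p. f (snd p))"
    using int(2) unfolding \<pi>(4)[symmetric] by (subst (asm) integrable_distr_eq) auto
  have "(\<integral>x. f x \<partial>\<mu>) - (\<integral>x. f x \<partial>\<nu>) = (\<integral>p. f (fst p) - f (snd p) \<partial>\<pi>)"
    using i1 i2 unfolding \<pi>(3)[symmetric] \<pi>(4)[symmetric]
    by (simp add: integral_distr)
  then have "ennreal (norm ((\<integral>x. f x \<partial>\<mu>) - (\<integral>x. f x \<partial>\<nu>))) \<le> (\<integral>\<^sup>+p. norm (f (fst p) - f (snd p)) \<partial>\<pi>)"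
    using integral_norm_bound_ennreal[OF Bochner_Integration.integrable_diff[OF i1 i2]] by simp
  also have "\<dots> \<le> (\<integral>\<^sup>+(x, y). ennreal (norm (x - y)) \<partial>\<pi>)"
    using lip by (intro nn_integral_mono) (auto intro!: ennreal_leI)
  finally show "ennreal (norm ((\<integral>x. f x \<partial>\<mu>) - (\<integral>x. f x \<partial>\<nu>))) \<le> (\<integral>\<^sup>+(x, y). ennreal (norm (x - y)) \<partial>\<pi>)" .
qed

lemma W1_tendsto_integral_lipschitz:
  fixes f :: "real ^ 'n \<Rightarrow> 'b :: {banach, second_countable_topology}"
  assumes W: "(\<lambda>k. W1 (\<mu>s k) \<mu>) \<longlonglongrightarrow> 0"
    and int: "\<And>k. integrable (\<mu>s k) f" "integrable \<mu> f"
    and [measurable]: "f \<in> borel_measurable borel"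
    and lip: "\<And>x y. norm (f x - f y) \<le> L * norm (x - y)"
  shows "(\<lambda>k. \<integral>x. f x \<partial>\<mu>s k) \<longlonglongrightarrow> (\<integral>x. f x \<partial>\<mu>)"
proof -
  \<comment> \<open>Dividing by a positive Lipschitz constant makes the function 1-Lipschitz.\<close>
  define K where "K = max L 1"
  have K: "K > 0" by (simp add: K_def)
  define g where "g x = inverse K *\<^sub>R f x" for x
  have g_lip: "norm (g x - g y) \<le> norm (x - y)" for x y
  proof -
    have "norm (f x - f y) \<le> K * norm (x - y)"
      using lip[of x y] mult_right_mono[of L K "norm (x - y)"] by (simp add: K_def)
    then show ?thesis
      using K unfolding g_def scaleR_right_diff_distrib[symmetric] norm_scaleR
      by (simp add: field_simps)
  qed
  have "ennreal (norm ((\<integral>x. g x \<partial>\<mu>s k) - (\<integral>x. g x \<partial>\<mu>))) \<le> W1 (\<mu>s k) \<mu>" for k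
    using int g_lip by (intro integral_diff_le_W1) (auto simp: g_def)
  then have "(\<lambda>k. ennreal (norm ((\<integral>x. g x \<partial>\<mu>s k) - (\<integral>x. g x \<partial>\<mu>)))) \<longlonglongrightarrow> 0"
    by (intro tendsto_sandwich[OF _ _ tendsto_const W]) auto
  then have "(\<lambda>k. \<integral>x. g x \<partial>\<mu>s k) \<longlonglongrightarrow> (\<integral>x. g x \<partial>\<mu>)"
    by (simp add: ennreal_tendsto_0_iff tendsto_norm_zero_iff LIM_zero_iff)
  then have "(\<lambda>k. K *\<^sub>R (\<integral>x. g x \<partial>\<mu>s k)) \<longlonglongrightarrow> K *\<^sub>R (\<integral>x. g x \<partial>\<mu>)"
    by (intro tendsto_intros)
  then show ?thesis using K by (simp add: g_def)
qed

section \<open>Characteristic functions\<close>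

definition characteristic :: "(real ^ 'n) measure \<Rightarrow> real ^ 'n \<Rightarrow> complex" where
  "characteristic M t = (\<integral>x. iexp (t \<bullet> x) \<partial>M)"

lemma norm_characteristic_le:
  "M \<in> borel_prob_measures \<Longrightarrow> norm (characteristic M t) \<le> 1"
  unfolding characteristic_def
  by (intro prob_space.norm_integral_le_bound borel_prob_measuresD) auto

lemma borel_measurable_characteristic [measurable]:
  assumes "M \<in> borel_prob_measures"
  shows "characteristic M \<in> borel_measurable borel"
proof -
  note M = borel_prob_measuresD[OF assms]
  note [measurable_cong] = M(2)
  interpret prob_space M by fact
  show ?thesis unfolding characteristic_def[abs_def] by measurable
qed

lemma integrable_iexp_inner:
  "M \<in> borel_prob_measures \<Longrightarrow> integrable M (\<lambda>x. iexp (t \<bullet> x))"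
  by (rule integrable_bounded_borel[where B=1]) auto

lemma characteristic_convolution:
  assumes "M \<in> borel_prob_measures" "N \<in> borel_prob_measures"
  shows "characteristic (M \<star> N) t = characteristic M t * characteristic N t"
  unfolding characteristic_def
  using assms
  by (subst integral_convolution)
     (auto simp: integrable_iexp_inner convolution_in_borel_prob_measures inner_add_right
        distrib_left exp_add)

lemma norm_iexp_diff_le: "norm (iexp a - iexp b) \<le> \<bar>a - b\<bar>"
proof -
  have "iexp a - iexp b = iexp b * (iexp (a - b) - 1)"
    by (simp add: algebra_simps flip: exp_add)
  then have "norm (iexp a - iexp b) = norm (iexp (a - b) - 1)"
    by (simp add: norm_mult)
  then show ?thesis using iexp_approx1[of "a - b" 0] by simp
qed

text \<open>Characters are Lipschitz, so the characteristic functions of the smoothed measures converge.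
  These are the original ones multiplied by the everywhere positive factor
  \<open>exp (- (\<sigma> |t|)\<^sup>2 / 2)\<close>, which cancels.\<close>

lemma characteristic_tendsto:
  assumes "\<sigma> \<ge> 0" and \<mu>s: "\<And>k. \<mu>s k \<in> borel_prob_measures" and \<mu>: "\<mu> \<in> borel_prob_measures"
    and W: "(\<lambda>k. smoothed_W1 \<sigma> (\<mu>s k) \<mu>) \<longlonglongrightarrow> 0"
  shows "(\<lambda>k. characteristic (\<mu>s k) t) \<longlonglongrightarrow> characteristic \<mu> t"
proof -
  note g = gaussian_in_borel_prob_measures
  let ?c = "complex_of_real (exp (- (\<sigma> * norm t)\<^sup>2 / 2))"
  have eq: "characteristic (M \<star> gaussian \<sigma>) t = characteristic M t * ?c"
    if "M \<in> borel_prob_measures" for M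
    using that characteristic_convolution[OF that g] integral_iexp_gaussian[OF assms(1), of t]
    by (simp add: characteristic_def)
  have "(\<lambda>k. characteristic (\<mu>s k \<star> gaussian \<sigma>) t) \<longlonglongrightarrow> characteristic (\<mu> \<star> gaussian \<sigma>) t"
    unfolding characteristic_def
  proof (rule W1_tendsto_integral_lipschitz[where L = "norm t"])
    show "norm (iexp (t \<bullet> x) - iexp (t \<bullet> y)) \<le> norm t * norm (x - y)" for x y
      using norm_iexp_diff_le[of "t \<bullet> x" "t \<bullet> y"] Cauchy_Schwarz_ineq2[of t "x - y"]
      by (simp add: inner_diff_right)
  qed (use W in \<open>auto intro!: integrable_iexp_inner convolution_in_borel_prob_measures g \<mu>s \<mu>
        simp: smoothed_W1_def\<close>)
  then have "(\<lambda>k. characteristic (\<mu>s k) t * ?c) \<longlonglongrightarrow> characteristic \<mu> t * ?c"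
    by (simp add: eq \<mu>s \<mu> del: of_real_exp)
  then have "(\<lambda>k. characteristic (\<mu>s k) t * ?c / ?c) \<longlonglongrightarrow> characteristic \<mu> t * ?c / ?c"
    by (intro tendsto_divide tendsto_const) auto
  then show ?thesis by simp
qed

text \<open>This is Fourier inversion after Gaussian smoothing: the function
  \<open>exp (- (s |x - y|)\<^sup>2 / 2)\<close> is the characteristic function of \<open>N\<^sub>s\<close> at \<open>x - y\<close>, and Fubini moves the
  integral over \<open>M\<close> inside.\<close>

lemma integral_exp_square_eq_characteristic:
  assumes "M \<in> borel_prob_measures" "s \<ge> 0"
  shows "complex_of_real (\<integral>x. exp (- (s * norm (x - y))\<^sup>2 / 2) \<partial>M) =
    (\<integral>t. iexp (- (t \<bullet> y)) * characteristic M t \<partial>gaussian s)"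
proof -
  note M = borel_prob_measuresD[OF assms(1)]
  note [measurable_cong] = M(2)
  let ?G = "gaussian s :: (real ^ 'n) measure"
  interpret M: prob_space M by fact
  interpret G: prob_space ?G by (rule prob_space_gaussian)
  interpret P: pair_prob_space M ?G ..
  let ?f = "\<lambda>x t. iexp (- (t \<bullet> y)) * iexp (t \<bullet> x)"
  have i: "integrable (M \<Otimes>\<^sub>M ?G) (case_prod ?f)"
    by (rule P.integrable_const_bound[where B=1]) (auto simp: norm_mult)
  have "complex_of_real (\<integral>x. exp (- (s * norm (x - y))\<^sup>2 / 2) \<partial>M) =
      (\<integral>x. complex_of_real (exp (- (s * norm (x - y))\<^sup>2 / 2)) \<partial>M)"
    by simp
  also have "\<dots> = (\<integral>x. \<integral>t. ?f x t \<partial>?G \<partial>M)"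
    unfolding integral_iexp_gaussian[OF assms(2), symmetric]
    by (intro Bochner_Integration.integral_cong refl)
       (simp add: inner_diff_left inner_commute algebra_simps flip: exp_add)
  also have "\<dots> = (\<integral>t. \<integral>x. ?f x t \<partial>M \<partial>?G)"
    using P.Fubini_integral[OF i] by simp
  finally show ?thesis by (simp add: characteristic_def)
qed

text \<open>The integrals are the values at \<open>y\<close> of the densities of the measures smoothed with \<open>N\<^sub>\<epsilon>\<close>. They
  converge by dominated convergence in frequency space, where the relevant Gaussian has
  standard deviation \<open>1 / \<epsilon>\<close>.\<close>

lemma integral_gaussian_density_tendsto:
  fixes y :: "real ^ 'n"
  assumes \<mu>s: "\<And>k. \<mu>s k \<in> borel_prob_measures" and \<mu>: "\<mu> \<in> borel_prob_measures"
    and char: "\<And>t. (\<lambda>k. characteristic (\<mu>s k) t) \<longlonglongrightarrow> characteristic \<mu> t" and "\<epsilon> > 0"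
  shows "(\<lambda>k. \<integral>x. gaussian_density \<epsilon> (y - x) \<partial>\<mu>s k) \<longlonglongrightarrow> (\<integral>x. gaussian_density \<epsilon> (y - x) \<partial>\<mu>)"
proof -
  let ?e = "\<lambda>x. exp (- (inverse \<epsilon> * norm (x - y))\<^sup>2 / 2)"
  let ?G = "gaussian (inverse \<epsilon>) :: (real ^ 'n) measure"
  interpret G: prob_space ?G by (rule prob_space_gaussian)
  note [measurable] = borel_measurable_characteristic[OF \<mu>] borel_measurable_characteristic[OF \<mu>s]
  have "(\<lambda>k. \<integral>t. iexp (- (t \<bullet> y)) * characteristic (\<mu>s k) t \<partial>?G)
      \<longlonglongrightarrow> (\<integral>t. iexp (- (t \<bullet> y)) * characteristic \<mu> t \<partial>?G)"
    by (rule integral_dominated_convergence[where w = "\<lambda>_. 1"])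
       (auto intro!: tendsto_intros char simp: norm_mult norm_characteristic_le \<mu>s)
  then have "(\<lambda>k. complex_of_real (\<integral>x. ?e x \<partial>\<mu>s k)) \<longlonglongrightarrow> complex_of_real (\<integral>x. ?e x \<partial>\<mu>)"
    by (subst (1 2) integral_exp_square_eq_characteristic) (use assms in auto)
  then have *: "(\<lambda>k. \<integral>x. ?e x \<partial>\<mu>s k) \<longlonglongrightarrow> (\<integral>x. ?e x \<partial>\<mu>)"
    by (simp only: tendsto_of_real_iff)
  have "gaussian_density \<epsilon> (y - x) = 1 / sqrt (2 * pi * \<epsilon>\<^sup>2) ^ CARD('n) * ?e x" for x
    by (simp add: gaussian_density_def norm_minus_commute power_mult_distrib field_simps)
  then show ?thesis
    using tendsto_mult[OF tendsto_const * , of "1 / sqrt (2 * pi * \<epsilon>\<^sup>2) ^ CARD('n)"] by simp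
qed

section \<open>From characteristic functions to weak convergence\<close>

text \<open>Pointwise convergence of probability densities already forces convergence in \<open>L\<^sup>1\<close>, hence
  convergence of the integrals of any bounded function.\<close>

lemma Scheffe_integral_tendsto:
  fixes g :: "nat \<Rightarrow> 'a \<Rightarrow> real" and f :: "'a \<Rightarrow> real"
  assumes "\<And>k x. 0 \<le> g k x" "\<And>x. 0 \<le> h x"
    and [measurable]: "\<And>k. g k \<in> borel_measurable M" "h \<in> borel_measurable M"
      "f \<in> borel_measurable M"
    and prob: "\<And>k. prob_space (density M (\<lambda>x. ennreal (g k x)))" "prob_space (density M (\<lambda>x. ennreal (h x)))"
    and lim: "\<And>x. (\<lambda>k. g k x) \<longlonglongrightarrow> h x"
    and B: "\<And>x. \<bar>f x\<bar> \<le> B"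
  shows "(\<lambda>k. \<integral>x. f x \<partial>density M (\<lambda>x. ennreal (g k x))) \<longlonglongrightarrow> (\<integral>x. f x \<partial>density M (\<lambda>x. ennreal (h x)))"
proof -
  have mass: "(\<integral>\<^sup>+x. ennreal (g k x) \<partial>M) = 1" "(\<integral>\<^sup>+x. ennreal (h x) \<partial>M) = 1" for k
    using prob_space.emeasure_space_1[OF prob(1)[of k]] prob_space.emeasure_space_1[OF prob(2)]
    by (simp_all add: emeasure_density cong: nn_integral_cong)
  have int: "integrable M (g k)" "integrable M h" for k
    using assms(1,2) mass by (auto intro!: integrableI_nonneg)
  have "(\<lambda>k. \<integral>\<^sup>+x. norm (g k x - h x) \<partial>M) \<longlonglongrightarrow> 0"
    using assms(1,2) int lim by (intro Scheffe_lemma2) (auto simp: mass)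
  moreover have "(\<integral>\<^sup>+x. norm (g k x - h x) \<partial>M) = ennreal (\<integral>x. norm (g k x - h x) \<partial>M)" for k
    using int by (intro nn_integral_eq_integral) auto
  ultimately have L1: "(\<lambda>k. \<integral>x. norm (g k x - h x) \<partial>M) \<longlonglongrightarrow> 0"
    by (simp add: ennreal_tendsto_0_iff)
  have intf: "integrable M (\<lambda>x. u x *\<^sub>R f x)" if u: "integrable M u" for u
  proof -
    have [measurable]: "u \<in> borel_measurable M" using u by simp
    have dom: "integrable M (\<lambda>x. norm (u x) * B)" using u by simp
    have le: "norm (u x *\<^sub>R f x) \<le> norm (norm (u x) * B)" for x
      using mult_left_mono[OF B[of x] abs_ge_zero[of "u x"]] abs_ge_self[of "\<bar>u x\<bar> * B"]
      by (simp add: abs_mult)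
    show ?thesis
      by (rule Bochner_Integration.integrable_bound[OF dom _ AE_I2[OF le]]) measurable
  qed
  have "norm ((\<integral>x. f x \<partial>density M (\<lambda>x. ennreal (g k x))) - (\<integral>x. f x \<partial>density M (\<lambda>x. ennreal (h x))))
      \<le> B * (\<integral>x. norm (g k x - h x) \<partial>M)" for k
  proof -
    have "(\<integral>x. f x \<partial>density M (\<lambda>x. ennreal (g k x))) - (\<integral>x. f x \<partial>density M (\<lambda>x. ennreal (h x)))
        = (\<integral>x. (g k x - h x) *\<^sub>R f x \<partial>M)"
      using assms(1,2) intf[OF int(1)[of k]] intf[OF int(2)]
      by (simp add: integral_density left_diff_distrib)
    then have "norm ((\<integral>x. f x \<partial>density M (\<lambda>x. ennreal (g k x))) - (\<integral>x. f x \<partial>density M (\<lambda>x. ennreal (h x))))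
        = norm (\<integral>x. (g k x - h x) *\<^sub>R f x \<partial>M)"
      by (rule arg_cong)
    also have "norm (\<integral>x. (g k x - h x) *\<^sub>R f x \<partial>M) \<le> (\<integral>x. norm ((g k x - h x) *\<^sub>R f x) \<partial>M)"
      by (rule integral_norm_bound)
    also have "(\<integral>x. norm ((g k x - h x) *\<^sub>R f x) \<partial>M) \<le> (\<integral>x. B * norm (g k x - h x) \<partial>M)"
    proof (rule integral_mono)
      show "integrable M (\<lambda>x. norm ((g k x - h x) *\<^sub>R f x))"
        by (intro integrable_norm intf Bochner_Integration.integrable_diff int)
      show "norm ((g k x - h x) *\<^sub>R f x) \<le> B * norm (g k x - h x)" for x
        using mult_right_mono[OF B[of x] abs_ge_zero[of "g k x - h x"]] by (simp add: abs_mult mult.commute)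
    qed (use int in simp)
    also have "(\<integral>x. B * norm (g k x - h x) \<partial>M) = B * (\<integral>x. norm (g k x - h x) \<partial>M)"
      by simp
    finally show ?thesis .
  qed
  then show ?thesis
    by (intro LIM_zero_cancel[OF Lim_null_comparison[OF always_eventually[OF allI] tendsto_mult_right_zero[OF L1]]])
qed

lemma convolution_gaussian_integral_tendsto:
  fixes \<mu>s :: "nat \<Rightarrow> (real ^ 'n) measure" and f :: "real ^ 'n \<Rightarrow> real"
  assumes \<mu>s: "\<And>k. \<mu>s k \<in> borel_prob_measures" and \<mu>: "\<mu> \<in> borel_prob_measures"
    and char: "\<And>t. (\<lambda>k. characteristic (\<mu>s k) t) \<longlonglongrightarrow> characteristic \<mu> t" and "\<epsilon> > 0"
    and [measurable]: "f \<in> borel_measurable borel" and B: "\<And>x. \<bar>f x\<bar> \<le> B"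
  shows "(\<lambda>k. \<integral>x. f x \<partial>(\<mu>s k \<star> gaussian \<epsilon>)) \<longlonglongrightarrow> (\<integral>x. f x \<partial>(\<mu> \<star> gaussian \<epsilon>))"
proof -
  have meas: "(\<lambda>y. \<integral>x. gaussian_density \<epsilon> (y - x) \<partial>M) \<in> borel_measurable borel"
    if "M \<in> borel_prob_measures" for M :: "(real ^ 'n) measure"
  proof -
    note [measurable_cong] = borel_prob_measuresD(2)[OF that]
    interpret prob_space M by (rule borel_prob_measuresD[OF that])
    show ?thesis by measurable
  qed
  have prob: "prob_space (density lborel (\<lambda>y. ennreal (\<integral>x. gaussian_density \<epsilon> (y - x) \<partial>M)))"
    if "M \<in> borel_prob_measures" for M :: "(real ^ 'n) measure"
    unfolding convolution_gaussian_eq_density[OF that assms(4), symmetric]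
    by (rule borel_prob_measuresD convolution_in_borel_prob_measures that gaussian_in_borel_prob_measures)+
  show ?thesis
    unfolding convolution_gaussian_eq_density[OF \<mu>s assms(4)] convolution_gaussian_eq_density[OF \<mu> assms(4)]
    by (rule Scheffe_integral_tendsto[where B=B])
       (auto intro!: integral_nonneg_AE meas prob \<mu>s \<mu> B integral_gaussian_density_tendsto char assms(4))
qed

text \<open>Smoothing moves each point by a distance of expectation \<open>E |Z|\<close>, where \<open>Z\<close> has law \<open>N\<^sub>\<epsilon>\<close>. The
  bound is uniform in \<open>M\<close>, which is what allows \<open>\<epsilon>\<close> to be chosen before passing to the limit
  along the sequence.\<close>

lemma convolution_gaussian_lipschitz_error:
  fixes f :: "real ^ 'n \<Rightarrow> real"
  assumes M: "M \<in> borel_prob_measures" and "\<epsilon> \<ge> 0" "L \<ge> 0"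
    and [measurable]: "f \<in> borel_measurable borel" and B: "\<And>x. \<bar>f x\<bar> \<le> B"
    and lip: "\<And>x y. \<bar>f x - f y\<bar> \<le> L * norm (x - y)"
  shows "\<bar>(\<integral>x. f x \<partial>(M \<star> gaussian \<epsilon>)) - (\<integral>x. f x \<partial>M)\<bar> \<le> L * (\<epsilon> * sqrt 2 ^ CARD('n))"
proof -
  let ?G = "gaussian \<epsilon> :: (real ^ 'n) measure"
  note [measurable_cong] = borel_prob_measuresD(2)[OF M]
  interpret M: prob_space M by (rule borel_prob_measuresD[OF M])
  interpret G: prob_space ?G by (rule prob_space_gaussian)
  have ig: "integrable ?G (\<lambda>y. f (x + y))" for x
    by (rule integrable_bounded_borel[OF gaussian_in_borel_prob_measures, where B=B]) (auto simp: B)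
  have im: "integrable M (\<lambda>x. \<integral>y. f (x + y) \<partial>?G)"
    using B by (intro M.integrable_const_bound[where B=B] AE_I2 G.norm_integral_le_bound) auto
  have "(\<integral>x. f x \<partial>(M \<star> ?G)) - (\<integral>x. f x \<partial>M) = (\<integral>x. (\<integral>y. f (x + y) \<partial>?G) - f x \<partial>M)"
  proof -
    have "integrable M f" "integrable (M \<star> ?G) f"
      using B by (auto intro!: integrable_bounded_borel[where B=B] M
          gaussian_in_borel_prob_measures convolution_in_borel_prob_measures)
    then show ?thesis
      using im by (simp add: integral_convolution[OF M gaussian_in_borel_prob_measures])
  qed
  also have "\<dots> = (\<integral>x. (\<integral>y. f (x + y) - f x \<partial>?G) \<partial>M)"
    using ig by (simp add: G.prob_space)
  also have "\<bar>\<dots>\<bar> \<le> (\<integral>x. L * (\<epsilon> * sqrt 2 ^ CARD('n)) \<partial>M)"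
  proof -
    have *: "norm (\<integral>y. f (x + y) - f x \<partial>?G) \<le> L * (\<epsilon> * sqrt 2 ^ CARD('n))" for x
    proof -
      have "norm (\<integral>y. f (x + y) - f x \<partial>?G) \<le> (\<integral>y. L * norm y \<partial>?G)"
        using lip[of "x + _" x] ig gaussian_first_moment[OF assms(2), where 'n='n]
        by (intro Bochner_Integration.integral_norm_bound_integral) auto
      also have "\<dots> \<le> L * (\<epsilon> * sqrt 2 ^ CARD('n))"
        using gaussian_first_moment(2)[OF assms(2), where 'n='n] assms(3)
        by (simp add: mult_left_mono)
      finally show ?thesis .
    qed
    show ?thesis
      using M.norm_integral_le_bound[OF *] by (simp add: M.prob_space)
  qed
  finally show ?thesis by (simp add: M.prob_space)
qed

text \<open>The usual three-term estimate: replace both measures by their smoothed versions, with an \<open>\<epsilon>\<close> small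
  compared with \<open>1 / L\<close>.\<close>

lemma lipschitz_integral_tendsto:
  fixes \<mu>s :: "nat \<Rightarrow> (real ^ 'n) measure"
  assumes \<mu>s: "\<And>k. \<mu>s k \<in> borel_prob_measures" and \<mu>: "\<mu> \<in> borel_prob_measures"
    and char: "\<And>t. (\<lambda>k. characteristic (\<mu>s k) t) \<longlonglongrightarrow> characteristic \<mu> t"
    and [measurable]: "f \<in> borel_measurable borel" and B: "\<And>x. \<bar>f x\<bar> \<le> B"
    and lip: "\<And>x y. \<bar>f x - f y\<bar> \<le> L * norm (x - y)" and "L \<ge> 0"
  shows "(\<lambda>k. \<integral>x. f x \<partial>\<mu>s k) \<longlonglongrightarrow> (\<integral>x. f x \<partial>\<mu>)"
proof (rule LIMSEQ_I)
  fix r :: real assume r: "r > 0"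
  define c where "c = (L + 1) * sqrt 2 ^ CARD('n)"
  have c: "c > 0" using assms(7) by (simp add: c_def add_nonneg_pos)
  \<comment> \<open>Each of the two smoothing errors becomes at most \<open>r / 4\<close>.\<close>
  define \<epsilon> where "\<epsilon> = r / (4 * c)"
  have \<epsilon>: "\<epsilon> > 0" using c r by (simp add: \<epsilon>_def)
  have "L * (\<epsilon> * sqrt 2 ^ CARD('n)) \<le> \<epsilon> * c"
    using \<epsilon> by (simp add: c_def algebra_simps)
  also have "\<dots> = r / 4" using c by (simp add: \<epsilon>_def)
  finally have err: "\<bar>(\<integral>x. f x \<partial>(M \<star> gaussian \<epsilon>)) - (\<integral>x. f x \<partial>M)\<bar> \<le> r / 4"
    if "M \<in> borel_prob_measures" for M
    using convolution_gaussian_lipschitz_error[OF that less_imp_le[OF \<epsilon>] assms(7,4) B lip] by linarith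
  from LIMSEQ_D[OF convolution_gaussian_integral_tendsto[OF \<mu>s \<mu> char \<epsilon> assms(4) B], of "r / 4"] r
  obtain N where N: "\<And>k. k \<ge> N \<Longrightarrow> \<bar>(\<integral>x. f x \<partial>(\<mu>s k \<star> gaussian \<epsilon>)) - (\<integral>x. f x \<partial>(\<mu> \<star> gaussian \<epsilon>))\<bar> < r / 4"
    by auto
  then have "norm ((\<integral>x. f x \<partial>\<mu>s k) - (\<integral>x. f x \<partial>\<mu>)) < r" if "k \<ge> N" for k
    using err[OF \<mu>s[of k]] err[OF \<mu>] N[OF that] r unfolding real_norm_def by linarith
  then show "\<exists>N. \<forall>k\<ge>N. norm ((\<integral>x. f x \<partial>\<mu>s k) - (\<integral>x. f x \<partial>\<mu>)) < r" by blast
qed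

text \<open>The approximants are the infimal convolutions of \<open>f\<close> with \<open>n |x|\<close>. Away from \<open>x\<close> the penalty
  \<open>n |x - y|\<close> eventually exceeds the oscillation \<open>2 B\<close> of \<open>f\<close>, so only points close to \<open>x\<close> compete
  in the infimum.\<close>

lemma lipschitz_approx_below:
  fixes f :: "'a :: real_normed_vector \<Rightarrow> real"
  assumes cont: "continuous_on UNIV f" and B: "\<And>x. \<bar>f x\<bar> \<le> B"
  obtains F :: "nat \<Rightarrow> 'a \<Rightarrow> real" where
    "\<And>n x. F n x \<le> f x" "\<And>n x. \<bar>F n x\<bar> \<le> B"
    "\<And>n x y. \<bar>F n x - F n y\<bar> \<le> real n * norm (x - y)"
    "\<And>x. (\<lambda>n. F n x) \<longlonglongrightarrow> f x"
proof -
  define F where "F n x = (INF y. f y + real n * norm (x - y))" for n :: nat and x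
  have lb: "- B \<le> f y + real n * norm (x - y)" for x y n
    using B[of y] by (smt (verit) mult_nonneg_nonneg norm_ge_zero of_nat_0_le_iff)
  have bdd: "bdd_below (range (\<lambda>y. f y + real n * norm (x - y)))" for n x
    using lb by (intro bdd_belowI2) auto
  have ge: "- B \<le> F n x" for n x
    unfolding F_def by (rule cINF_greatest) (auto simp: lb)
  have le: "F n x \<le> f y + real n * norm (x - y)" for n x y
    unfolding F_def by (rule cINF_lower[OF bdd]) auto
  have lef: "F n x \<le> f x" for n x
    using le[of n x x] by simp
  have abs: "\<bar>F n x\<bar> \<le> B" for n x
    using ge[of n x] lef[of n x] B[of x] by linarith
  have lip1: "F n x - F n y \<le> real n * norm (x - y)" for n x y
  proof -
    have "F n x - real n * norm (x - y) \<le> F n y"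
      unfolding F_def[of n y]
    proof (rule cINF_greatest)
      fix z
      have "norm (x - z) \<le> norm (x - y) + norm (y - z)"
        using norm_triangle_ineq[of "x - y" "y - z"] by simp
      then have "real n * norm (x - z) \<le> real n * norm (x - y) + real n * norm (y - z)"
        by (metis mult_left_mono of_nat_0_le_iff distrib_left)
      then show "F n x - real n * norm (x - y) \<le> f z + real n * norm (y - z)"
        using le[of n x z] by linarith
    qed simp
    then show ?thesis by linarith
  qed
  have lip: "\<bar>F n x - F n y\<bar> \<le> real n * norm (x - y)" for n x y
    using lip1[of n x y] lip1[of n y x] by (simp add: norm_minus_commute abs_le_iff)
  have lim: "(\<lambda>n. F n x) \<longlonglongrightarrow> f x" for x
  proof (rule LIMSEQ_I)
    fix r :: real assume r: "r > 0"
    obtain d where d: "d > 0" "\<And>y. dist y x < d \<Longrightarrow> dist (f y) (f x) < r / 2"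
      using cont r unfolding continuous_on_iff by (metis UNIV_I half_gt_zero)
    obtain N :: nat where N: "real N * d > 2 * B" 
      using reals_Archimedean3[OF d(1)] by blast
    have "f x - r / 2 \<le> F n x" if "n \<ge> N" for n
      unfolding F_def
    proof (rule cINF_greatest)
      fix y
      show "f x - r / 2 \<le> f y + real n * norm (x - y)"
      proof (cases "dist y x < d")
        case True
        then have "f x - r / 2 \<le> f y" using d(2)[of y] unfolding dist_real_def by linarith
        then show ?thesis by (smt (verit) mult_nonneg_nonneg norm_ge_zero of_nat_0_le_iff)
      next
        case False
        then have "real N * d \<le> real n * norm (x - y)"
          using that d(1) by (intro mult_mono) (auto simp: dist_norm norm_minus_commute)
        then show ?thesis using N B[of x] B[of y] r by linarith
      qed
    qed simp
    then have "norm (F n x - f x) < r" if "n \<ge> N" for n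
      using lef[of n x] r that by (smt (verit) real_norm_def field_sum_of_halves)
    then show "\<exists>N. \<forall>n\<ge>N. norm (F n x - f x) < r" by blast
  qed
  show ?thesis using that lef abs lip lim by blast
qed

text \<open>Approximating \<open>f\<close> from below by Lipschitz functions yields only that the limit inferior of the
  integrals is at least the integral in the limit; the same bound for \<open>- f\<close> gives the rest.\<close>

lemma weakly_converges_if_lipschitz:
  fixes \<mu>s :: "nat \<Rightarrow> (real ^ 'n) measure"
  assumes \<mu>s: "\<And>k. \<mu>s k \<in> borel_prob_measures" and \<mu>: "\<mu> \<in> borel_prob_measures"
    and lip: "\<And>f B L. \<lbrakk>f \<in> borel_measurable borel; \<And>x. \<bar>f x\<bar> \<le> B;
      \<And>x y. \<bar>f x - f y\<bar> \<le> L * norm (x - y); L \<ge> 0\<rbrakk> \<Longrightarrow>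
      (\<lambda>k. \<integral>x. f x \<partial>\<mu>s k) \<longlonglongrightarrow> (\<integral>x. f x \<partial>\<mu>)"
  shows "weakly_converges \<mu>s \<mu>"
proof -
  have lower: "eventually (\<lambda>k. (\<integral>x. f x \<partial>\<mu>) - r < (\<integral>x. f x \<partial>\<mu>s k)) sequentially"
    if cont: "continuous_on UNIV f" and B: "\<And>x. \<bar>f x\<bar> \<le> B" and r: "r > 0" for f :: "real ^ 'n \<Rightarrow> real" and B r
  proof -
    obtain F where F: "\<And>n x. F n x \<le> f x" "\<And>n x. \<bar>F n x\<bar> \<le> B"
      "\<And>n x y. \<bar>F n x - F n y\<bar> \<le> real n * norm (x - y)" "\<And>x. (\<lambda>n. F n x) \<longlonglongrightarrow> f x"
      using lipschitz_approx_below[OF cont B] by metis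
    have [measurable]: "f \<in> borel_measurable borel"
      using cont by (rule borel_measurable_continuous_onI)
    have "continuous_on UNIV (F n)" for n
    proof (rule lipschitz_on_continuous_on[where L = "real n"])
      show "(real n)-lipschitz_on UNIV (F n)"
        using F(3) by (intro lipschitz_onI) (auto simp: dist_norm)
    qed
    then have [measurable]: "F n \<in> borel_measurable borel" for n
      by (rule borel_measurable_continuous_onI)
    have "(\<lambda>n. \<integral>x. F n x \<partial>\<mu>) \<longlonglongrightarrow> (\<integral>x. f x \<partial>\<mu>)"
      using borel_prob_measuresD(2)[OF \<mu>] F(2,4) integrable_bounded_borel[OF \<mu>, of "\<lambda>_. B" "\<bar>B\<bar>"]
      by (intro integral_dominated_convergence[where w = "\<lambda>_. B"]) (auto simp: measurable_cong_sets[OF borel_prob_measuresD(2)[OF \<mu>] refl])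
    then have "eventually (\<lambda>n. (\<integral>x. f x \<partial>\<mu>) - r < (\<integral>x. F n x \<partial>\<mu>)) sequentially"
      using r by (intro order_tendstoD) auto
    then obtain n where n: "(\<integral>x. f x \<partial>\<mu>) - r < (\<integral>x. F n x \<partial>\<mu>)"
      by (auto simp: eventually_sequentially)
    have "(\<lambda>k. \<integral>x. F n x \<partial>\<mu>s k) \<longlonglongrightarrow> (\<integral>x. F n x \<partial>\<mu>)"
      using F by (intro lip[where B=B and L="real n"]) auto
    from order_tendstoD(1)[OF this n] show ?thesis
    proof eventually_elim
      case (elim k)
      have "(\<integral>x. F n x \<partial>\<mu>s k) \<le> (\<integral>x. f x \<partial>\<mu>s k)"
        using F B by (intro integral_mono integrable_bounded_borel[OF \<mu>s, where B=B]) auto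
      with elim show ?case by simp
    qed
  qed
  show ?thesis
    unfolding weakly_converges_def
  proof (intro allI impI)
    fix f :: "real ^ 'n \<Rightarrow> real" assume cont: "continuous_on UNIV f" and "bounded (range f)"
    then obtain B where B: "\<And>x. \<bar>f x\<bar> \<le> B" by (auto simp: bounded_iff)
    show "(\<lambda>k. \<integral>x. f x \<partial>\<mu>s k) \<longlonglongrightarrow> (\<integral>x. f x \<partial>\<mu>)"
    proof (rule tendstoI)
      fix r :: real assume r: "r > 0"
      have "eventually (\<lambda>k. (\<integral>x. - f x \<partial>\<mu>) - r < (\<integral>x. - f x \<partial>\<mu>s k)) sequentially"
        using cont B r by (intro lower continuous_on_minus) auto
      with lower[OF cont B r]
      show "eventually (\<lambda>k. dist (\<integral>x. f x \<partial>\<mu>s k) (\<integral>x. f x \<partial>\<mu>) < r) sequentially"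
        by eventually_elim (auto simp: dist_real_def)
    qed
  qed
qed

section \<open>Consequences of smoothed convergence\<close>

lemma weakly_converges_if_smoothed_W1:
  fixes \<mu>s :: "nat \<Rightarrow> (real ^ 'n) measure"
  assumes "\<sigma> \<ge> 0" and \<mu>s: "\<And>k. \<mu>s k \<in> borel_prob_measures" and \<mu>: "\<mu> \<in> borel_prob_measures"
    and W: "(\<lambda>k. smoothed_W1 \<sigma> (\<mu>s k) \<mu>) \<longlonglongrightarrow> 0"
  shows "weakly_converges \<mu>s \<mu>"
  using \<mu>s \<mu> lipschitz_integral_tendsto[OF \<mu>s \<mu> characteristic_tendsto[OF assms]]
  by (rule weakly_converges_if_lipschitz) blast+

text \<open>The norm is unbounded, so weak convergence does not apply to it. It does apply to the gain
  \<open>h x = E |x + Z| - |x|\<close> caused by smoothing, since \<open>|h| \<le> E |Z|\<close>; the norm itself is handled by its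
  Lipschitz continuity.\<close>

lemma moments_tendsto_if_smoothed_W1:
  fixes \<mu>s :: "nat \<Rightarrow> (real ^ 'n) measure"
  assumes "\<sigma> \<ge> 0" and \<mu>s: "\<And>k. \<mu>s k \<in> borel_prob_measures1" and \<mu>: "\<mu> \<in> borel_prob_measures1"
    and W: "(\<lambda>k. smoothed_W1 \<sigma> (\<mu>s k) \<mu>) \<longlonglongrightarrow> 0"
  shows "(\<lambda>k. \<integral>x. norm x \<partial>\<mu>s k) \<longlonglongrightarrow> (\<integral>x. norm x \<partial>\<mu>)"
proof -
  let ?G = "gaussian \<sigma> :: (real ^ 'n) measure"
  interpret G: prob_space ?G by (rule prob_space_gaussian)
  note g1 = gaussian_in_borel_prob_measures1[OF assms(1), where 'n='n]
  note g = gaussian_first_moment(1)[OF assms(1), where 'n='n]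
  define h where "h x = (\<integral>z. norm (x + z) \<partial>?G) - norm x" for x :: "real ^ 'n"
  have i: "integrable ?G (\<lambda>z. norm (x + z))" for x
    using g by (intro Bochner_Integration.integrable_bound[OF Bochner_Integration.integrable_add[OF G.integrable_const[of "norm x"] g]])
      (auto intro: norm_triangle_ineq)
  have h: "h x = (\<integral>z. norm (x + z) - norm x \<partial>?G)" for x
    using i by (simp add: h_def G.prob_space)
  have bound: "\<bar>h x\<bar> \<le> (\<integral>z. norm z \<partial>?G)" for x
    unfolding h real_norm_def[symmetric]
    using i g norm_triangle_ineq3[of "x + _" x]
    by (intro Bochner_Integration.integral_norm_bound_integral) auto
  have "\<bar>(\<integral>z. norm (x + z) \<partial>?G) - (\<integral>z. norm (y + z) \<partial>?G)\<bar> \<le> norm (x - y)" for x y :: "real ^ 'n"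
  proof -
    have "norm (\<integral>z. norm (x + z) - norm (y + z) \<partial>?G) \<le> (\<integral>z. norm (x - y) \<partial>?G)"
    proof (intro Bochner_Integration.integral_norm_bound_integral)
      show "norm (norm (x + z) - norm (y + z)) \<le> norm (x - y)" for z
        using norm_triangle_ineq3[of "x + z" "y + z"] by simp
    qed (use i in auto)
    then show ?thesis using i by (simp add: G.prob_space)
  qed
  then have "1-lipschitz_on UNIV (\<lambda>x :: real ^ 'n. \<integral>z. norm (x + z) \<partial>?G)"
    by (intro lipschitz_onI) (auto simp: dist_norm)
  then have cont: "continuous_on UNIV h"
    unfolding h_def[abs_def] by (intro continuous_intros lipschitz_on_continuous_on)
  have "weakly_converges \<mu>s \<mu>"
    using assms(1) borel_prob_measures1D(1)[OF \<mu>s] borel_prob_measures1D(1)[OF \<mu>] W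
    by (rule weakly_converges_if_smoothed_W1)
  moreover have "bounded (range h)"
    using bound by (auto simp: bounded_iff)
  ultimately have 1: "(\<lambda>k. \<integral>x. h x \<partial>\<mu>s k) \<longlonglongrightarrow> (\<integral>x. h x \<partial>\<mu>)"
    using cont by (simp add: weakly_converges_def)
  have 2: "(\<lambda>k. \<integral>x. norm x \<partial>(\<mu>s k \<star> ?G)) \<longlonglongrightarrow> (\<integral>x. norm x \<partial>(\<mu> \<star> ?G))"
    using W norm_triangle_ineq3
    by (intro W1_tendsto_integral_lipschitz[where L=1])
       (auto simp: smoothed_W1_def intro!: borel_prob_measures1D convolution_in_borel_prob_measures1 g1 \<mu>s \<mu>)
  have "(\<integral>x. norm x \<partial>(M \<star> ?G)) - (\<integral>x. h x \<partial>M) = (\<integral>x. norm x \<partial>M)"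
    if "M \<in> borel_prob_measures1" for M
  proof -
    note M = borel_prob_measures1D[OF that]
    have ih: "integrable M h"
      using bound borel_measurable_continuous_onI[OF cont] by (intro integrable_bounded_borel[OF M(1)]) auto
    have "(\<integral>x. norm x \<partial>(M \<star> ?G)) = (\<integral>x. h x + norm x \<partial>M)"
      using that M borel_prob_measures1D[OF g1] borel_prob_measures1D(2)[OF convolution_in_borel_prob_measures1[OF that g1]]
      by (subst integral_convolution) (auto simp: h_def)
    then show ?thesis using ih M by simp
  qed
  with tendsto_diff[OF 2 1] \<mu>s \<mu> show ?thesis by simp
qed

section \<open>Smoothing contracts the transport distance\<close>

text \<open>From a coupling \<open>(X, Y)\<close> and an independent \<open>Z\<close> with law \<open>N\<^sub>\<sigma>\<close>, the pair \<open>(X + Z, Y + Z)\<close> couples the smoothed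
  measures at the same cost.\<close>

lemma smoothed_W1_le_W1:
  assumes \<mu>: "\<mu> \<in> borel_prob_measures" and \<nu>: "\<nu> \<in> borel_prob_measures"
  shows "smoothed_W1 \<sigma> \<mu> \<nu> \<le> W1 \<mu> (\<nu> :: (real ^ 'n) measure)"
  unfolding W1_def[of \<mu> \<nu>]
proof (rule INF_greatest)
  let ?G = "gaussian \<sigma> :: (real ^ 'n) measure"
  fix \<pi> assume "\<pi> \<in> couplings \<mu> \<nu>"
  note \<pi> = couplingsD[OF this]
  have sb: "sets \<pi> = sets (borel \<Otimes>\<^sub>M borel)" unfolding \<pi>(2) borel_prod ..
  note [measurable_cong] = sb
  interpret G: prob_space ?G by (rule prob_space_gaussian)
  interpret Q: prob_space \<pi> by (rule \<pi>)
  interpret P: pair_prob_space \<pi> ?G ..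
  let ?sh = "\<lambda>(p :: (real ^ 'n) \<times> (real ^ 'n), z). (fst p + z, snd p + z)"
  let ?\<pi> = "distr (\<pi> \<Otimes>\<^sub>M ?G) (borel \<Otimes>\<^sub>M borel) ?sh"
  have marg: "distr ?\<pi> borel f = (distr \<pi> borel f \<star> ?G)"
    if [measurable]: "f \<in> borel \<Otimes>\<^sub>M borel \<rightarrow>\<^sub>M borel"
      and f: "\<And>p z. f (fst p + z, snd p + z) = f p + z" for f :: "(real ^ 'n) \<times> (real ^ 'n) \<Rightarrow> real ^ 'n"
  proof -
    have "distr \<pi> borel f \<Otimes>\<^sub>M ?G = distr \<pi> borel f \<Otimes>\<^sub>M distr ?G borel (\<lambda>z. z)"
      by (simp add: distr_id2)
    also have "\<dots> = distr (\<pi> \<Otimes>\<^sub>M ?G) (borel \<Otimes>\<^sub>M borel) (\<lambda>(p, z). (f p, z))"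
      by (rule pair_measure_distr) (auto simp: distr_id2 G.sigma_finite_measure_axioms)
    finally show ?thesis
      unfolding convolution_def
      by (simp add: distr_distr comp_def split_beta' f)
  qed
  have "prob_space ?\<pi>" by (rule P.prob_space_distr) measurable
  moreover have "sets ?\<pi> = sets borel" by (simp only: sets_distr borel_prod)
  moreover have "distr ?\<pi> borel fst = (\<mu> \<star> ?G)" "distr ?\<pi> borel snd = (\<nu> \<star> ?G)"
    using marg[of fst] marg[of snd] \<pi>(3,4) by simp_all
  ultimately have "?\<pi> \<in> couplings (\<mu> \<star> ?G) (\<nu> \<star> ?G)"
    by (simp add: couplings_def)
  then have "smoothed_W1 \<sigma> \<mu> \<nu> \<le> (\<integral>\<^sup>+(x, y). ennreal (norm (x - y)) \<partial>?\<pi>)"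
    unfolding smoothed_W1_def W1_def by (rule INF_lower)
  also have "\<dots> = (\<integral>\<^sup>+(p, z). ennreal (norm (fst p - snd p)) \<partial>(\<pi> \<Otimes>\<^sub>M ?G))"
    by (simp add: nn_integral_distr split_beta')
  also have "\<dots> = (\<integral>\<^sup>+p. \<integral>\<^sup>+z. ennreal (norm (fst p - snd p)) \<partial>?G \<partial>\<pi>)"
    by (subst G.nn_integral_fst[symmetric]) auto
  also have "\<dots> = (\<integral>\<^sup>+(x, y). ennreal (norm (x - y)) \<partial>\<pi>)"
    by (simp add: G.emeasure_space_1 split_beta')
  finally show "smoothed_W1 \<sigma> \<mu> \<nu> \<le> (\<integral>\<^sup>+(x, y). ennreal (norm (x - y)) \<partial>\<pi>)" .
qed

lemma smoothed_W1_0: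
  fixes \<mu> \<nu> :: "(real ^ 'n) measure"
  assumes "\<mu> \<in> borel_prob_measures" "\<nu> \<in> borel_prob_measures"
  shows "smoothed_W1 0 \<mu> \<nu> = W1 \<mu> \<nu>"
proof -
  have "(M \<star> gaussian 0) = M" if M: "M \<in> borel_prob_measures" for M :: "(real ^ 'n) measure"
  proof (rule measure_eqI)
    note [measurable_cong] = borel_prob_measuresD(2)[OF M]
    interpret prob_space M by (rule borel_prob_measuresD[OF M])
    interpret G: prob_space "gaussian 0 :: (real ^ 'n) measure" by (rule prob_space_gaussian)
    fix A assume "A \<in> sets (M \<star> gaussian 0)"
    then have [measurable]: "A \<in> sets borel" by simp
    have "emeasure (M \<star> gaussian 0) A = (\<integral>\<^sup>+x. \<integral>\<^sup>+y. indicator A (x + y) \<partial>gaussian 0 \<partial>M)"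
      using borel_prob_measuresD[OF M]
      by (intro convolution_emeasure') (auto simp: finite_measure_axioms G.finite_measure_axioms)
    also have "\<dots> = emeasure M A"
      by (simp add: gaussian_def nn_integral_return)
    finally show "emeasure (M \<star> gaussian 0) A = emeasure M A" .
  qed (simp add: borel_prob_measuresD[OF M])
  with assms show ?thesis by (simp add: smoothed_W1_def)
qed

section \<open>An explicit coupling\<close>

lemma sets_borel_pair:
  assumes "M \<in> borel_prob_measures" "N \<in> borel_prob_measures"
  shows "sets (M \<Otimes>\<^sub>M N) = sets borel"
  using sets_pair_measure_cong[OF assms[THEN borel_prob_measuresD(2)]] unfolding borel_prod .

lemma density_in_couplings:
  fixes M N :: "(real ^ 'n) measure"
  assumes M: "M \<in> borel_prob_measures" and N: "N \<in> borel_prob_measures"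
    and q[measurable]: "q \<in> borel_measurable (borel \<Otimes>\<^sub>M borel)"
    and q1: "AE x in M. (\<integral>\<^sup>+y. q (x, y) \<partial>N) = 1" and q2: "AE y in N. (\<integral>\<^sup>+x. q (x, y) \<partial>M) = 1"
  shows "density (M \<Otimes>\<^sub>M N) q \<in> couplings M N"
proof -
  note [measurable_cong] = borel_prob_measuresD(2)[OF M] borel_prob_measuresD(2)[OF N]
  interpret M: prob_space M by (rule borel_prob_measuresD[OF M])
  interpret N: prob_space N by (rule borel_prob_measuresD[OF N])
  interpret P: pair_prob_space M N ..
  let ?\<pi> = "density (M \<Otimes>\<^sub>M N) q"
  have "distr ?\<pi> borel fst = M"
  proof (rule measure_eqI)
    fix S assume "S \<in> sets (distr ?\<pi> borel fst)"
    then have [measurable]: "S \<in> sets borel" by simp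
    have "emeasure (distr ?\<pi> borel fst) S = (\<integral>\<^sup>+p. indicator S (fst p) \<partial>?\<pi>)"
      by (subst nn_integral_distr[symmetric, where M' = borel]) auto
    also have "\<dots> = (\<integral>\<^sup>+p. q p * indicator S (fst p) \<partial>(M \<Otimes>\<^sub>M N))"
      by (simp add: nn_integral_density)
    also have "\<dots> = (\<integral>\<^sup>+x. (\<integral>\<^sup>+y. q (x, y) \<partial>N) * indicator S x \<partial>M)"
      by (simp add: N.nn_integral_fst[symmetric] nn_integral_multc)
    also have "\<dots> = (\<integral>\<^sup>+x. indicator S x \<partial>M)"
      using q1 by (intro nn_integral_cong_AE) auto
    finally show "emeasure (distr ?\<pi> borel fst) S = emeasure M S"
      by simp
  qed (simp add: borel_prob_measuresD[OF M])
  moreover have "distr ?\<pi> borel snd = N"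
  proof (rule measure_eqI)
    fix S assume "S \<in> sets (distr ?\<pi> borel snd)"
    then have [measurable]: "S \<in> sets borel" by simp
    have "emeasure (distr ?\<pi> borel snd) S = (\<integral>\<^sup>+p. indicator S (snd p) \<partial>?\<pi>)"
      by (subst nn_integral_distr[symmetric, where M' = borel]) auto
    also have "\<dots> = (\<integral>\<^sup>+p. q p * indicator S (snd p) \<partial>(M \<Otimes>\<^sub>M N))"
      by (simp add: nn_integral_density)
    also have "\<dots> = (\<integral>\<^sup>+y. (\<integral>\<^sup>+x. q (x, y) \<partial>M) * indicator S y \<partial>N)"
      by (simp add: P.nn_integral_snd[symmetric] nn_integral_multc)
    also have "\<dots> = (\<integral>\<^sup>+y. indicator S y \<partial>N)"
      using q2 by (intro nn_integral_cong_AE) auto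
    finally show "emeasure (distr ?\<pi> borel snd) S = emeasure N S"
      by simp
  qed (simp add: borel_prob_measuresD[OF N])
  moreover have "prob_space ?\<pi>"
  proof (rule prob_spaceI)
    have "emeasure ?\<pi> (space ?\<pi>) = (\<integral>\<^sup>+x. \<integral>\<^sup>+y. q (x, y) \<partial>N \<partial>M)"
      by (simp add: emeasure_density N.nn_integral_fst[symmetric] cong: nn_integral_cong)
    also have "\<dots> = (\<integral>\<^sup>+x. 1 \<partial>M)"
      using q1 by (intro nn_integral_cong_AE) auto
    finally show "emeasure ?\<pi> (space ?\<pi>) = 1" by (simp add: M.emeasure_space_1)
  qed
  ultimately show ?thesis
    using sets_borel_pair[OF M N] by (simp add: couplings_def)
qed

text \<open>Here \<open>u\<close> is the fraction of \<open>M\<close> that is left over after a partial coupling and \<open>m\<close> its mass.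
  If \<open>m = 0\<close>, division by zero gives \<open>0\<close>, which is harmless because \<open>u\<close> then vanishes almost everywhere;
  this is why the last fact holds only almost everywhere.\<close>

lemma normalized_remainder:
  assumes M: "M \<in> borel_prob_measures" and [measurable]: "u \<in> borel_measurable borel" 
    and u: "\<And>x. 0 \<le> u x" "\<And>x. u x \<le> 1" and m: "m = (\<integral>x. u x \<partial>M)"
  shows "integrable M u" "(\<integral>\<^sup>+x. ennreal (u x / m) \<partial>M) \<le> 1" "AE x in M. u x * m / m = u x"
proof -
  note [measurable_cong] = borel_prob_measuresD(2)[OF M]
  show i: "integrable M u"
    by (rule integrable_bounded_borel[OF M, where B=1]) (auto simp: u)
  have m0: "0 \<le> m" unfolding m using u by (intro integral_nonneg_AE) auto
  have "(\<integral>\<^sup>+x. ennreal (u x / m) \<partial>M) = ennreal (\<integral>x. u x / m \<partial>M)"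
    using i u m0 by (intro nn_integral_eq_integral) auto
  also have "(\<integral>x. u x / m \<partial>M) = m / m" using i by (simp add: m)
  finally show "(\<integral>\<^sup>+x. ennreal (u x / m) \<partial>M) \<le> 1" by (simp add: divide_self_if)
  show "AE x in M. u x * m / m = u x"
  proof (cases "m = 0")
    case True
    then have "AE x in M. u x = 0"
      using integral_nonneg_eq_0_iff_AE[OF i] u m by auto
    then show ?thesis by eventually_elim simp
  qed simp
qed

text \<open>The coupling has the density
  \<open>\<Sum>\<^sub>j \<phi>\<^sub>j x * \<phi>\<^sub>j y / max (a j) (b j) + (1 - A x) * (1 - B y) / m\<close> with respect to the product of the two
  measures. The sum couples the mass \<open>min (a j) (b j)\<close> inside each bump; dividing by the maximum is what
  makes its marginal densities \<open>A\<close> and \<open>B\<close> stay below \<open>1\<close>. Both marginals then miss the same mass \<open>m\<close>, which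
  the product term fills in. The first part moves mass by at most \<open>\<delta>\<close>; in the
  second part \<open>|x - y| \<le> |x| + |y|\<close>, which yields the two remaining integrals. If \<open>a j\<close> and
  \<open>b j\<close> are both zero, the quotients are zero, as they should be.\<close>

lemma W1_le_local_coupling:
  fixes \<mu> \<nu> :: "(real ^ 'n) measure" and \<phi> :: "'i \<Rightarrow> real ^ 'n \<Rightarrow> real"
  assumes \<mu>1: "\<mu> \<in> borel_prob_measures1" and \<nu>1: "\<nu> \<in> borel_prob_measures1" and I: "finite I"
    and [measurable]: "\<And>j. j \<in> I \<Longrightarrow> \<phi> j \<in> borel_measurable borel"
    and \<phi>0: "\<And>j x. j \<in> I \<Longrightarrow> 0 \<le> \<phi> j x" and \<phi>1: "\<And>x. (\<Sum>j\<in>I. \<phi> j x) \<le> 1"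
    and diam: "\<And>j x y. \<lbrakk>j \<in> I; \<phi> j x \<noteq> 0; \<phi> j y \<noteq> 0\<rbrakk> \<Longrightarrow> norm (x - y) \<le> \<delta>" and "\<delta> \<ge> 0"
  defines "a \<equiv> \<lambda>j. \<integral>x. \<phi> j x \<partial>\<mu>" and "b \<equiv> \<lambda>j. \<integral>x. \<phi> j x \<partial>\<nu>"
  shows "W1 \<mu> \<nu> \<le> ennreal (\<delta> + (\<integral>x. norm x * (1 - (\<Sum>j\<in>I. b j / max (a j) (b j) * \<phi> j x)) \<partial>\<mu>)
    + (\<integral>y. norm y * (1 - (\<Sum>j\<in>I. a j / max (a j) (b j) * \<phi> j y)) \<partial>\<nu>))"
proof -
  note \<mu> = borel_prob_measures1D(1)[OF \<mu>1] and \<nu> = borel_prob_measures1D(1)[OF \<nu>1]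
  note [measurable_cong] = borel_prob_measuresD(2)[OF \<mu>] borel_prob_measuresD(2)[OF \<nu>]
  interpret \<mu>: prob_space \<mu> by (rule borel_prob_measuresD[OF \<mu>])
  interpret \<nu>: prob_space \<nu> by (rule borel_prob_measuresD[OF \<nu>])
  interpret P: pair_prob_space \<mu> \<nu> ..
  have \<phi>_le: "\<phi> j x \<le> 1" if "j \<in> I" for j x
    using member_le_sum[OF that _ I, of "\<lambda>j. \<phi> j x"] \<phi>0 \<phi>1[of x] by fastforce
  have i\<phi>: "integrable \<mu> (\<phi> j)" "integrable \<nu> (\<phi> j)" if "j \<in> I" for j
    using that \<phi>0 \<phi>_le by (auto intro!: integrable_bounded_borel[where B=1] \<mu> \<nu>)
  have a0: "0 \<le> a j" and b0: "0 \<le> b j" if "j \<in> I" for j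
    using that \<phi>0 by (auto simp: a_def b_def intro!: integral_nonneg_AE)
  have rat: "b j / max (a j) (b j) \<in> {0..1}" "a j / max (a j) (b j) \<in> {0..1}" if "j \<in> I" for j
    using a0[OF that] b0[OF that] by (auto simp: divide_simps max_def)
  define A where "A x = (\<Sum>j\<in>I. b j / max (a j) (b j) * \<phi> j x)" for x
  define B where "B y = (\<Sum>j\<in>I. a j / max (a j) (b j) * \<phi> j y)" for y
  have [measurable]: "A \<in> borel_measurable borel" "B \<in> borel_measurable borel"
    unfolding A_def[abs_def] B_def[abs_def] by measurable
  have "0 \<le> A x" "0 \<le> B x" for x
    unfolding A_def B_def by (intro sum_nonneg mult_nonneg_nonneg; use rat \<phi>0 in auto)+
  moreover have "A x \<le> (\<Sum>j\<in>I. \<phi> j x)" "B x \<le> (\<Sum>j\<in>I. \<phi> j x)" for x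
    unfolding A_def B_def by (intro sum_mono mult_left_le_one_le; use rat \<phi>0 in auto)+
  ultimately have AB: "0 \<le> A x" "A x \<le> 1" "0 \<le> B x" "B x \<le> 1" for x
    using \<phi>1[of x] order_trans by blast+
  define m where "m = 1 - (\<Sum>j\<in>I. a j * b j / max (a j) (b j))"
  have mA: "m = (\<integral>x. 1 - A x \<partial>\<mu>)"
    using i\<phi>(1) by (simp add: A_def m_def \<mu>.prob_space a_def mult_ac)
  have mB: "m = (\<integral>x. 1 - B x \<partial>\<nu>)"
    using i\<phi>(2) by (simp add: B_def m_def \<nu>.prob_space b_def mult_ac)
  have m0: "0 \<le> m" unfolding mA using AB by (intro integral_nonneg_AE) auto
  have AB': "0 \<le> 1 - A x" "1 - A x \<le> 1" "0 \<le> 1 - B x" "1 - B x \<le> 1" for x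
    using AB[of x] by auto
  have mes: "(\<lambda>x. 1 - A x) \<in> borel_measurable borel" "(\<lambda>x. 1 - B x) \<in> borel_measurable borel"
    by measurable
  note RA = normalized_remainder[OF \<mu> mes(1) AB'(1,2) mA]
  note RB = normalized_remainder[OF \<nu> mes(2) AB'(3,4) mB]
  define q0 where "q0 x y = (\<Sum>j\<in>I. \<phi> j x * \<phi> j y / max (a j) (b j))" for x y
  define r where "r x y = (1 - A x) * (1 - B y) / m" for x y
  have q0: "0 \<le> q0 x y" for x y
    unfolding q0_def using \<phi>0 a0 by (auto intro!: sum_nonneg divide_nonneg_nonneg simp: le_max_iff_disj)
  have r0: "0 \<le> r x y" for x y
    unfolding r_def using AB' m0 by simp
  have [measurable]: "(\<lambda>p. q0 (fst p) (snd p)) \<in> borel_measurable (borel \<Otimes>\<^sub>M borel)"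
    "(\<lambda>p. r (fst p) (snd p)) \<in> borel_measurable (borel \<Otimes>\<^sub>M borel)"
    unfolding q0_def r_def by measurable
  have q0x: "has_bochner_integral \<nu> (q0 x) (A x)" for x
    using i\<phi>(2) unfolding q0_def[abs_def]
    by (auto simp: has_bochner_integral_iff A_def b_def mult_ac intro!: sum.cong)
  have q0y: "has_bochner_integral \<mu> (\<lambda>x. q0 x y) (B y)" for y
    using i\<phi>(1) unfolding q0_def[abs_def]
    by (auto simp: has_bochner_integral_iff B_def a_def mult_ac intro!: sum.cong)
  have rx: "has_bochner_integral \<nu> (r x) ((1 - A x) * m / m)" for x
    using RB(1) unfolding r_def[abs_def] by (auto simp: has_bochner_integral_iff mB)
  have ry: "has_bochner_integral \<mu> (\<lambda>x. r x y) ((1 - B y) * m / m)" for y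
    using RA(1) unfolding r_def[abs_def] by (auto simp: has_bochner_integral_iff mA mult_ac)
  let ?q = "\<lambda>p. ennreal (q0 (fst p) (snd p) + r (fst p) (snd p))"
  have "AE x in \<mu>. (\<integral>\<^sup>+y. ?q (x, y) \<partial>\<nu>) = 1"
    using RA(3)
  proof eventually_elim
    case (elim x)
    have "has_bochner_integral \<nu> (\<lambda>y. q0 x y + r x y) 1"
      using has_bochner_integral_add[OF q0x[of x] rx[of x]] elim by simp
    then show ?case
      using q0 r0 by (simp add: nn_integral_eq_integral has_bochner_integral_iff del: ennreal_plus)
  qed
  moreover have "AE y in \<nu>. (\<integral>\<^sup>+x. ?q (x, y) \<partial>\<mu>) = 1"
    using RB(3)
  proof eventually_elim
    case (elim y)
    have "has_bochner_integral \<mu> (\<lambda>x. q0 x y + r x y) 1"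
      using has_bochner_integral_add[OF q0y[of y] ry[of y]] elim by simp
    then show ?case
      using q0 r0 by (simp add: nn_integral_eq_integral has_bochner_integral_iff del: ennreal_plus)
  qed
  ultimately have cpl: "density (\<mu> \<Otimes>\<^sub>M \<nu>) ?q \<in> couplings \<mu> \<nu>"
    by (intro density_in_couplings \<mu> \<nu>) measurable
  have q0_loc: "norm (x - y) * q0 x y \<le> \<delta> * q0 x y" for x y
    unfolding q0_def sum_distrib_left
  proof (rule sum_mono)
    fix j assume j: "j \<in> I"
    show "norm (x - y) * (\<phi> j x * \<phi> j y / max (a j) (b j)) \<le> \<delta> * (\<phi> j x * \<phi> j y / max (a j) (b j))"
    proof (cases "\<phi> j x = 0 \<or> \<phi> j y = 0")
      case False
      then show ?thesis
        by (intro mult_right_mono divide_nonneg_nonneg mult_nonneg_nonneg diam[OF j] \<phi>0[OF j]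
            order_trans[OF a0[OF j] max.cobounded1]) simp_all
    qed auto
  qed
  have cost_le: "norm (x - y) * (q0 x y + r x y) \<le> \<delta> * (q0 x y + r x y) + norm x * r x y + norm y * r x y" for x y
  proof -
    have "norm (x - y) * r x y \<le> (norm x + norm y) * r x y"
      by (intro mult_right_mono norm_triangle_ineq4 r0)
    moreover have "0 \<le> \<delta> * r x y"
      by (intro mult_nonneg_nonneg assms(8) r0)
    ultimately show ?thesis
      using q0_loc[of x y] unfolding distrib_left distrib_right by linarith
  qed
  have pt: "?q p * ennreal (norm (fst p - snd p)) \<le> ennreal \<delta> * ?q p
      + ennreal (norm (fst p) * r (fst p) (snd p)) + ennreal (norm (snd p) * r (fst p) (snd p))" for p
  proof -
    define x y where "x = fst p" and "y = snd p"
    have "ennreal (q0 x y + r x y) * ennreal (norm (x - y)) = ennreal (norm (x - y) * (q0 x y + r x y))"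
      by (subst mult.commute, rule ennreal_mult[symmetric]) (use q0[of x y] r0[of x y] in auto)
    also have "\<dots> \<le> ennreal (\<delta> * (q0 x y + r x y) + norm x * r x y + norm y * r x y)"
      by (rule ennreal_leI[OF cost_le])
    also have "\<dots> = ennreal \<delta> * ennreal (q0 x y + r x y) + ennreal (norm x * r x y) + ennreal (norm y * r x y)"
    proof -
      have "ennreal (\<delta> * (q0 x y + r x y)) = ennreal \<delta> * ennreal (q0 x y + r x y)"
        by (rule ennreal_mult'[OF assms(8)])
      moreover have "0 \<le> \<delta> * (q0 x y + r x y)" "0 \<le> norm x * r x y" "0 \<le> norm y * r x y"
        by (intro mult_nonneg_nonneg add_nonneg_nonneg assms(8) q0 r0 norm_ge_zero)+
      ultimately show ?thesis by (simp only: ennreal_plus add_nonneg_nonneg)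
    qed
    finally show ?thesis by (simp only: x_def y_def)
  qed
  have tailA: "(\<integral>\<^sup>+x. \<integral>\<^sup>+y. ennreal (norm x * r x y) \<partial>\<nu> \<partial>\<mu>) \<le> ennreal (\<integral>x. norm x * (1 - A x) \<partial>\<mu>)"
  proof -
    have "(\<integral>\<^sup>+y. ennreal (norm x * r x y) \<partial>\<nu>) \<le> ennreal (norm x * (1 - A x))" for x
    proof -
      have "(\<integral>\<^sup>+y. ennreal (norm x * r x y) \<partial>\<nu>) = (\<integral>\<^sup>+y. ennreal (norm x * (1 - A x)) * ennreal ((1 - B y) / m) \<partial>\<nu>)"
        using AB' m0 by (simp add: r_def ennreal_mult'[symmetric] mult.assoc)
      also have "\<dots> = ennreal (norm x * (1 - A x)) * (\<integral>\<^sup>+y. ennreal ((1 - B y) / m) \<partial>\<nu>)"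
        by (rule nn_integral_cmult) measurable
      also have "\<dots> \<le> ennreal (norm x * (1 - A x)) * 1"
        by (intro mult_left_mono RB(2)) simp
      finally show ?thesis by simp
    qed
    then have "(\<integral>\<^sup>+x. \<integral>\<^sup>+y. ennreal (norm x * r x y) \<partial>\<nu> \<partial>\<mu>) \<le> (\<integral>\<^sup>+x. ennreal (norm x * (1 - A x)) \<partial>\<mu>)"
      by (rule nn_integral_mono)
    also have "\<dots> = ennreal (\<integral>x. norm x * (1 - A x) \<partial>\<mu>)"
      using AB' by (intro nn_integral_eq_integral Bochner_Integration.integrable_bound[OF borel_prob_measures1D(2)[OF \<mu>1]])
        (auto simp: abs_mult mult_left_le)
    finally show ?thesis .
  qed
  have tailB: "(\<integral>\<^sup>+y. \<integral>\<^sup>+x. ennreal (norm y * r x y) \<partial>\<mu> \<partial>\<nu>) \<le> ennreal (\<integral>y. norm y * (1 - B y) \<partial>\<nu>)"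
  proof -
    have "(\<integral>\<^sup>+x. ennreal (norm y * r x y) \<partial>\<mu>) \<le> ennreal (norm y * (1 - B y))" for y
    proof -
      have "(\<integral>\<^sup>+x. ennreal (norm y * r x y) \<partial>\<mu>) = (\<integral>\<^sup>+x. ennreal (norm y * (1 - B y)) * ennreal ((1 - A x) / m) \<partial>\<mu>)"
        using AB' m0 by (simp add: r_def ennreal_mult'[symmetric] mult_ac)
      also have "\<dots> = ennreal (norm y * (1 - B y)) * (\<integral>\<^sup>+x. ennreal ((1 - A x) / m) \<partial>\<mu>)"
        by (rule nn_integral_cmult) measurable
      also have "\<dots> \<le> ennreal (norm y * (1 - B y)) * 1"
        by (intro mult_left_mono RA(2)) simp
      finally show ?thesis by simp
    qed
    then have "(\<integral>\<^sup>+y. \<integral>\<^sup>+x. ennreal (norm y * r x y) \<partial>\<mu> \<partial>\<nu>) \<le> (\<integral>\<^sup>+y. ennreal (norm y * (1 - B y)) \<partial>\<nu>)"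
      by (rule nn_integral_mono)
    also have "\<dots> = ennreal (\<integral>y. norm y * (1 - B y) \<partial>\<nu>)"
      using AB' by (intro nn_integral_eq_integral Bochner_Integration.integrable_bound[OF borel_prob_measures1D(2)[OF \<nu>1]])
        (auto simp: abs_mult mult_left_le)
    finally show ?thesis .
  qed
  have add3: "(\<integral>\<^sup>+p. ennreal \<delta> * F p + G p + H p \<partial>(\<mu> \<Otimes>\<^sub>M \<nu>)) = ennreal \<delta> * (\<integral>\<^sup>+p. F p \<partial>(\<mu> \<Otimes>\<^sub>M \<nu>))
      + (\<integral>\<^sup>+p. G p \<partial>(\<mu> \<Otimes>\<^sub>M \<nu>)) + (\<integral>\<^sup>+p. H p \<partial>(\<mu> \<Otimes>\<^sub>M \<nu>))"
    if [measurable]: "F \<in> borel_measurable (\<mu> \<Otimes>\<^sub>M \<nu>)" "G \<in> borel_measurable (\<mu> \<Otimes>\<^sub>M \<nu>)"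
      "H \<in> borel_measurable (\<mu> \<Otimes>\<^sub>M \<nu>)" for F G H
    by (simp add: nn_integral_add nn_integral_cmult)
  have mass: "(\<integral>\<^sup>+p. ?q p \<partial>(\<mu> \<Otimes>\<^sub>M \<nu>)) = 1"
    using prob_space.emeasure_space_1[OF couplingsD(1)[OF cpl]]
    by (simp add: emeasure_density cong: nn_integral_cong)
  have "W1 \<mu> \<nu> \<le> (\<integral>\<^sup>+(x, y). ennreal (norm (x - y)) \<partial>density (\<mu> \<Otimes>\<^sub>M \<nu>) ?q)"
    unfolding W1_def by (rule INF_lower[OF cpl])
  also have "\<dots> = (\<integral>\<^sup>+p. ?q p * ennreal (norm (fst p - snd p)) \<partial>(\<mu> \<Otimes>\<^sub>M \<nu>))"
    by (simp add: split_beta' nn_integral_density)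
  also have "\<dots> \<le> (\<integral>\<^sup>+p. ennreal \<delta> * ?q p + ennreal (norm (fst p) * r (fst p) (snd p))
      + ennreal (norm (snd p) * r (fst p) (snd p)) \<partial>(\<mu> \<Otimes>\<^sub>M \<nu>))"
    by (intro nn_integral_mono pt)
  also have "\<dots> = ennreal \<delta> * (\<integral>\<^sup>+p. ?q p \<partial>(\<mu> \<Otimes>\<^sub>M \<nu>))
      + (\<integral>\<^sup>+p. ennreal (norm (fst p) * r (fst p) (snd p)) \<partial>(\<mu> \<Otimes>\<^sub>M \<nu>))
      + (\<integral>\<^sup>+p. ennreal (norm (snd p) * r (fst p) (snd p)) \<partial>(\<mu> \<Otimes>\<^sub>M \<nu>))"
    by (rule add3) measurable
  also have "(\<integral>\<^sup>+p. ennreal (norm (fst p) * r (fst p) (snd p)) \<partial>(\<mu> \<Otimes>\<^sub>M \<nu>)) =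
      (\<integral>\<^sup>+x. \<integral>\<^sup>+y. ennreal (norm x * r x y) \<partial>\<nu> \<partial>\<mu>)"
    by (subst \<nu>.nn_integral_fst[symmetric]) auto
  also have "(\<integral>\<^sup>+p. ennreal (norm (snd p) * r (fst p) (snd p)) \<partial>(\<mu> \<Otimes>\<^sub>M \<nu>)) =
      (\<integral>\<^sup>+y. \<integral>\<^sup>+x. ennreal (norm y * r x y) \<partial>\<mu> \<partial>\<nu>)"
    by (subst P.nn_integral_snd[symmetric]) auto
  also have "ennreal \<delta> * (\<integral>\<^sup>+p. ?q p \<partial>(\<mu> \<Otimes>\<^sub>M \<nu>)) + (\<integral>\<^sup>+x. \<integral>\<^sup>+y. ennreal (norm x * r x y) \<partial>\<nu> \<partial>\<mu>)
      + (\<integral>\<^sup>+y. \<integral>\<^sup>+x. ennreal (norm y * r x y) \<partial>\<mu> \<partial>\<nu>)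
      \<le> ennreal \<delta> + ennreal (\<integral>x. norm x * (1 - A x) \<partial>\<mu>) + ennreal (\<integral>y. norm y * (1 - B y) \<partial>\<nu>)"
    unfolding mass using tailA tailB by (intro add_mono) auto
  also have "\<dots> = ennreal (\<delta> + (\<integral>x. norm x * (1 - A x) \<partial>\<mu>) + (\<integral>y. norm y * (1 - B y) \<partial>\<nu>))"
  proof -
    have "0 \<le> (\<integral>x. norm x * (1 - A x) \<partial>\<mu>)" "0 \<le> (\<integral>y. norm y * (1 - B y) \<partial>\<nu>)"
      by (intro integral_nonneg_AE AE_I2 mult_nonneg_nonneg norm_ge_zero AB')+
    then show ?thesis
      using assms(8) by (simp only: ennreal_plus add_nonneg_nonneg)
  qed
  finally show ?thesis unfolding A_def B_def .
qed

section \<open>From weak convergence and moments to transport distance\<close>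

text \<open>Tent functions around a finite \<open>\<delta> / 2\<close>-net are normalized by the maximum of their sum and \<open>\<delta> / 2\<close>.
  On the ball the sum is at least \<open>\<delta> / 2\<close>, so there the bumps add up to \<open>1\<close>; elsewhere the maximum keeps
  them continuous and their sum below \<open>1\<close>.\<close>

lemma partition_of_unity_cball:
  fixes R \<delta> :: real
  assumes "\<delta> > 0"
  obtains I :: "(real ^ 'n) set" and \<phi> :: "real ^ 'n \<Rightarrow> real ^ 'n \<Rightarrow> real" where
    "finite I" "\<And>j. continuous_on UNIV (\<phi> j)" "\<And>j x. 0 \<le> \<phi> j x"
    "\<And>x. (\<Sum>j\<in>I. \<phi> j x) \<le> 1" "\<And>x. norm x \<le> R \<Longrightarrow> (\<Sum>j\<in>I. \<phi> j x) = 1"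
    "\<And>j x. \<phi> j x \<noteq> 0 \<Longrightarrow> dist j x < \<delta>"
proof -
  define d where "d = \<delta> / 2"
  have d: "d > 0" using assms by (simp add: d_def)
  obtain I where I: "finite I" "cball (0 :: real ^ 'n) R \<subseteq> (\<Union>x\<in>I. ball x d)"
    using compact_cball[of "0 :: real ^ 'n" R] d unfolding compact_eq_totally_bounded by blast
  define \<psi> where "\<psi> j x = max 0 (\<delta> - dist j x)" for j x :: "real ^ 'n"
  define s where "s x = (\<Sum>j\<in>I. \<psi> j x)" for x
  define \<phi> where "\<phi> j x = \<psi> j x / max d (s x)" for j x
  have \<psi>0: "0 \<le> \<psi> j x" for j x by (simp add: \<psi>_def)
  have pos: "max d (s x) > 0" for x using d by simp
  have sum: "(\<Sum>j\<in>I. \<phi> j x) = s x / max d (s x)" for x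
    by (simp add: \<phi>_def s_def sum_divide_distrib)
  show ?thesis
  proof (rule that[OF I(1)])
    show "continuous_on UNIV (\<phi> j)" for j
      unfolding \<phi>_def \<psi>_def s_def 
      by (intro continuous_intros ballI) (metis pos[unfolded s_def \<psi>_def] less_irrefl)
    show "0 \<le> \<phi> j x" for j x
      using \<psi>0 pos[of x] by (simp add: \<phi>_def)
    show "(\<Sum>j\<in>I. \<phi> j x) \<le> 1" for x
      unfolding sum using pos[of x] by (simp add: divide_le_eq_1)
    show "(\<Sum>j\<in>I. \<phi> j x) = 1" if "norm x \<le> R" for x
    proof -
      have "x \<in> cball 0 R" using that by simp
      then obtain j where j: "j \<in> I" "dist j x < d" using I(2) by auto
      then have "d \<le> \<psi> j x" by (simp add: \<psi>_def d_def le_max_iff_disj)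
      also have "\<dots> \<le> s x" unfolding s_def by (rule member_le_sum) (use j I \<psi>0 in auto)
      finally show ?thesis unfolding sum using d by (simp add: max_def)
    qed
    show "dist j x < \<delta>" if "\<phi> j x \<noteq> 0" for j x
      using that by (auto simp: \<phi>_def \<psi>_def max_def split: if_splits)
  qed
qed

lemma first_moment_tail:
  assumes M: "M \<in> borel_prob_measures1" and "e > 0"
  obtains R where "(\<integral>x. norm x * indicator {x. R < norm x} x \<partial>M) < e"
proof -
  note [measurable_cong] = borel_prob_measuresD(2)[OF borel_prob_measures1D(1)[OF M]]
  have "(\<lambda>n. \<integral>x. norm x * indicator {x. real n < norm x} x \<partial>M) \<longlonglongrightarrow> (\<integral>x. 0 \<partial>M)"
  proof (rule integral_dominated_convergence[where w = norm])
    show "AE x in M. (\<lambda>n. norm x * indicator {x. real n < norm x} x) \<longlonglongrightarrow> 0"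
    proof (rule AE_I2)
      fix x :: "real ^ 'a"
      have "eventually (\<lambda>n. norm x \<le> real n) sequentially"
        using filterlim_real_sequentially by (simp add: filterlim_at_top)
      then have "eventually (\<lambda>n. norm x * indicator {x. real n < norm x} x = 0) sequentially"
        by eventually_elim simp
      then show "(\<lambda>n. norm x * indicator {x. real n < norm x} x) \<longlonglongrightarrow> 0"
        by (rule tendsto_eventually)
    qed
  qed (use borel_prob_measures1D(2)[OF M] in \<open>auto simp: indicator_def\<close>)
  then have "eventually (\<lambda>n. (\<integral>x. norm x * indicator {x. real n < norm x} x \<partial>M) < e) sequentially"
    using assms(2) by (intro order_tendstoD) auto
  then show ?thesis using that by (auto simp: eventually_sequentially)
qed

text \<open>For a fixed partition of unity, every integral in the bound of \<open>W1_le_local_coupling\<close> is a first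
  moment minus finitely many integrals of the bounded continuous functions \<open>|x| \<phi>\<^sub>j x\<close>, so both
  error integrals converge to \<open>\<integral> |x| (1 - \<Sum>\<^sub>j \<phi>\<^sub>j x) d\<mu>\<close>, which is at most the tail of the first
  moment of \<open>\<mu>\<close> outside the ball of radius \<open>R\<close>.\<close>

lemma W1_tendsto_0_if_weakly_converges:
  fixes \<mu>s :: "nat \<Rightarrow> (real ^ 'n) measure"
  assumes \<mu>s: "\<And>k. \<mu>s k \<in> borel_prob_measures1" and \<mu>: "\<mu> \<in> borel_prob_measures1"
    and mom: "(\<lambda>k. \<integral>x. norm x \<partial>\<mu>s k) \<longlonglongrightarrow> (\<integral>x. norm x \<partial>\<mu>)"
    and weak: "weakly_converges \<mu>s \<mu>"
  shows "(\<lambda>k. W1 (\<mu>s k) \<mu>) \<longlonglongrightarrow> 0"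
proof -
  have ev: "eventually (\<lambda>k. W1 (\<mu>s k) \<mu> \<le> ennreal e) sequentially" if e: "e > 0" for e
  proof -
    obtain R where R: "(\<integral>x. norm x * indicator {x. R < norm x} x \<partial>\<mu>) < e / 4"
      using first_moment_tail[OF \<mu>, of "e / 4"] e by auto
    have e8: "e / 8 > 0" using e by simp
    show ?thesis
    proof (rule partition_of_unity_cball[OF e8, where R = R and 'n = 'n])
      fix I :: "(real ^ 'n) set" and \<phi> :: "real ^ 'n \<Rightarrow> real ^ 'n \<Rightarrow> real"
      assume \<phi>: "finite I" "\<And>j. continuous_on UNIV (\<phi> j)" "\<And>j x. 0 \<le> \<phi> j x"
        "\<And>x. (\<Sum>j\<in>I. \<phi> j x) \<le> 1" "\<And>x. norm x \<le> R \<Longrightarrow> (\<Sum>j\<in>I. \<phi> j x) = 1"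
        "\<And>j x. \<phi> j x \<noteq> 0 \<Longrightarrow> dist j x < e / 8"
      have meas [measurable]: "\<phi> j \<in> borel_measurable borel" for j
        by (rule borel_measurable_continuous_onI[OF \<phi>(2)])
      have \<phi>_le: "\<phi> j x \<le> 1" if "j \<in> I" for j x
      proof -
        have "\<phi> j x \<le> (\<Sum>j\<in>I. \<phi> j x)"
          by (rule member_le_sum) (use that \<phi>(1,3) in auto)
        also have "\<dots> \<le> 1" by (rule \<phi>(4))
        finally show ?thesis .
      qed
      have n\<phi>_le: "\<bar>norm x * \<phi> j x\<bar> \<le> norm j + e / 8" if "j \<in> I" for j x
      proof (cases "\<phi> j x = 0")
        case False
        have "norm x \<le> norm j + dist j x"
          using norm_triangle_ineq2[of x j] by (simp add: dist_norm norm_minus_commute)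
        then have "norm x \<le> norm j + e / 8" using \<phi>(6)[OF False] by linarith
        moreover have "norm x * \<phi> j x \<le> norm x" using \<phi>_le[OF that] by (simp add: mult_left_le)
        ultimately show ?thesis using \<phi>(3)[of j x] by (simp add: abs_mult)
      qed (use e in simp)
      define a where "a k j = (\<integral>x. \<phi> j x \<partial>\<mu>s k)" for k j
      define b where "b j = (\<integral>x. \<phi> j x \<partial>\<mu>)" for j
      have int\<phi>: "integrable M (\<phi> j)" "integrable M (\<lambda>x. norm x * \<phi> j x)"
        if "M \<in> borel_prob_measures" "j \<in> I" for M j
      proof -
        show "integrable M (\<phi> j)"
          using that(2) \<phi>(3) \<phi>_le by (intro integrable_bounded_borel[OF that(1), where B=1]) auto
        show "integrable M (\<lambda>x. norm x * \<phi> j x)"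
          using n\<phi>_le[OF that(2)] by (intro integrable_bounded_borel[OF that(1)]) auto
      qed
      note pm = borel_prob_measures1D(1)[OF \<mu>] and pms = borel_prob_measures1D(1)[OF \<mu>s]
      have a_lim: "(\<lambda>k. a k j) \<longlonglongrightarrow> b j" if "j \<in> I" for j
      proof -
        have "bounded (range (\<phi> j))"
          using \<phi>(3) \<phi>_le[OF that] by (auto simp: bounded_iff intro!: exI[of _ 1])
        then show ?thesis
          using weak \<phi>(2) by (simp add: weakly_converges_def a_def b_def)
      qed
      have n_lim: "(\<lambda>k. \<integral>x. norm x * \<phi> j x \<partial>\<mu>s k) \<longlonglongrightarrow> (\<integral>x. norm x * \<phi> j x \<partial>\<mu>)" if "j \<in> I" for j
      proof -
        have "bounded (range (\<lambda>x. norm x * \<phi> j x))"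
          using n\<phi>_le[OF that] by (auto simp: bounded_iff)
        moreover have "continuous_on UNIV (\<lambda>x. norm x * \<phi> j x)"
          by (intro continuous_intros \<phi>(2))
        ultimately show ?thesis
          using weak by (simp add: weakly_converges_def)
      qed
      \<comment> \<open>Bumps without mass in the limit need separate treatment: the quotient of the masses may fail to converge to \<open>1\<close>.\<close>
      have null: "(\<integral>x. norm x * \<phi> j x \<partial>\<mu>) = 0" if "j \<in> I" "b j = 0" for j
      proof -
        have "AE x in \<mu>. \<phi> j x = 0"
          using integral_nonneg_eq_0_iff_AE[OF int\<phi>(1)[OF pm that(1)]] \<phi>(3) that(2) by (auto simp: b_def)
        then have "AE x in \<mu>. norm x * \<phi> j x = 0" by eventually_elim simp
        then show ?thesis by (rule integral_eq_zero_AE)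
      qed
      have limA: "(\<lambda>k. b j / max (a k j) (b j) * (\<integral>x. norm x * \<phi> j x \<partial>\<mu>s k)) \<longlonglongrightarrow> (\<integral>x. norm x * \<phi> j x \<partial>\<mu>)"
        if j: "j \<in> I" for j
      proof (cases "b j = 0")
        case False
        then have "(\<lambda>k. b j / max (a k j) (b j) * (\<integral>x. norm x * \<phi> j x \<partial>\<mu>s k))
            \<longlonglongrightarrow> b j / max (b j) (b j) * (\<integral>x. norm x * \<phi> j x \<partial>\<mu>)"
          by (intro tendsto_intros a_lim n_lim j) auto
        with False show ?thesis by simp
      qed (simp add: null[OF j])
      have limB: "(\<lambda>k. a k j / max (a k j) (b j) * (\<integral>x. norm x * \<phi> j x \<partial>\<mu>)) \<longlonglongrightarrow> (\<integral>x. norm x * \<phi> j x \<partial>\<mu>)"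
        if j: "j \<in> I" for j
      proof (cases "b j = 0")
        case False
        then have "(\<lambda>k. a k j / max (a k j) (b j) * (\<integral>x. norm x * \<phi> j x \<partial>\<mu>))
            \<longlonglongrightarrow> b j / max (b j) (b j) * (\<integral>x. norm x * \<phi> j x \<partial>\<mu>)"
          by (intro tendsto_intros a_lim j) auto
        with False show ?thesis by simp
      qed (simp add: null[OF j])
      have expand: "(\<integral>x. norm x * (1 - (\<Sum>j\<in>I. c j * \<phi> j x)) \<partial>M) =
          (\<integral>x. norm x \<partial>M) - (\<Sum>j\<in>I. c j * (\<integral>x. norm x * \<phi> j x \<partial>M))"
        if M: "M \<in> borel_prob_measures1" for M and c :: "real ^ 'n \<Rightarrow> real"
      proof -
        note i = int\<phi>(2)[OF borel_prob_measures1D(1)[OF M]]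
        have "(\<integral>x. norm x * (1 - (\<Sum>j\<in>I. c j * \<phi> j x)) \<partial>M)
            = (\<integral>x. norm x - (\<Sum>j\<in>I. c j * (norm x * \<phi> j x)) \<partial>M)"
          by (simp add: right_diff_distrib sum_distrib_left mult_ac)
        also have "\<dots> = (\<integral>x. norm x \<partial>M) - (\<Sum>j\<in>I. c j * (\<integral>x. norm x * \<phi> j x \<partial>M))"
          using i borel_prob_measures1D(2)[OF M] by simp
        finally show ?thesis .
      qed
      define T where "T = (\<integral>x. norm x * (1 - (\<Sum>j\<in>I. 1 * \<phi> j x)) \<partial>\<mu>)"
      have "T \<le> (\<integral>x. norm x * indicator {x. R < norm x} x \<partial>\<mu>)"
        unfolding T_def
      proof (rule integral_mono)
        note [measurable_cong] = borel_prob_measuresD(2)[OF pm]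
        have rest: "0 \<le> 1 - (\<Sum>j\<in>I. 1 * \<phi> j x)" "1 - (\<Sum>j\<in>I. 1 * \<phi> j x) \<le> 1" for x
          using \<phi>(4)[of x] sum_nonneg[of I "\<lambda>j. \<phi> j x"] \<phi>(3) by auto
        show "integrable \<mu> (\<lambda>x. norm x * (1 - (\<Sum>j\<in>I. 1 * \<phi> j x)))"
        proof (rule Bochner_Integration.integrable_bound[OF borel_prob_measures1D(2)[OF \<mu>]])
          show "AE x in \<mu>. norm (norm x * (1 - (\<Sum>j\<in>I. 1 * \<phi> j x))) \<le> norm (norm x)"
            using mult_left_le[OF rest(2) norm_ge_zero] rest(1) by (intro AE_I2) (simp add: abs_mult)
        qed measurable
        show "integrable \<mu> (\<lambda>x. norm x * indicator {x. R < norm x} x)"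
          by (rule Bochner_Integration.integrable_bound[OF borel_prob_measures1D(2)[OF \<mu>]])
             (auto simp: indicator_def)
        show "norm x * (1 - (\<Sum>j\<in>I. 1 * \<phi> j x)) \<le> norm x * indicator {x. R < norm x} x" for x
          using \<phi>(5)[of x] mult_left_le[OF rest(2)[of x] norm_ge_zero[of x]]
          by (cases "norm x \<le> R") (simp_all del: mult_le_cancel_left1)
      qed
      with R have T: "T < e / 4" by simp
      have T_eq: "T = (\<integral>x. norm x \<partial>\<mu>) - (\<Sum>j\<in>I. \<integral>x. norm x * \<phi> j x \<partial>\<mu>)"
        unfolding T_def expand[OF \<mu>] by simp
      let ?S = "\<lambda>k. e / 4 + (\<integral>x. norm x * (1 - (\<Sum>j\<in>I. b j / max (a k j) (b j) * \<phi> j x)) \<partial>\<mu>s k)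
          + (\<integral>y. norm y * (1 - (\<Sum>j\<in>I. a k j / max (a k j) (b j) * \<phi> j y)) \<partial>\<mu>)"
      have "?S \<longlonglongrightarrow> e / 4 + T + T"
        unfolding T_eq expand[OF \<mu>s] expand[OF \<mu>]
        by (intro tendsto_intros mom limA limB)
      moreover have "e / 4 + T + T < e" using T e by linarith
      ultimately have "eventually (\<lambda>k. ?S k < e) sequentially"
        by (rule order_tendstoD)
      then show ?thesis
      proof eventually_elim
        case (elim k)
        have "W1 (\<mu>s k) \<mu> \<le> ennreal (?S k)"
          unfolding a_def b_def
        proof (rule W1_le_local_coupling[OF \<mu>s \<mu> \<phi>(1) meas \<phi>(3) \<phi>(4)])
          show "norm (x - y) \<le> e / 4" if "\<phi> j x \<noteq> 0" "\<phi> j y \<noteq> 0" for j x y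
            using \<phi>(6)[OF that(1)] \<phi>(6)[OF that(2)] dist_triangle3[of x y j] by (simp add: dist_norm)
        qed (use e in auto)
        also have "\<dots> \<le> ennreal e" using elim by (intro ennreal_leI) simp
        finally show ?case .
      qed
    qed
  qed
  show ?thesis
  proof (rule order_tendstoI)
    fix c :: ennreal assume "0 < c"
    then obtain x where x: "0 < x" "x < c" using dense by blast
    have "x < top" using x(2) top_greatest by (rule less_le_trans)
    define e where "e = enn2real x"
    have "e > 0" using x(1) \<open>x < top\<close> by (simp add: e_def enn2real_positive_iff)
    have "ennreal e < c" using x(2) \<open>x < top\<close> by (simp add: e_def)
    show "eventually (\<lambda>k. W1 (\<mu>s k) \<mu> < c) sequentially"
      using ev[OF \<open>e > 0\<close>] by eventually_elim (rule le_less_trans[OF _ \<open>ennreal e < c\<close>])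
  qed simp
qed

section \<open>Equivalence of the three modes of convergence\<close>

theorem theorem2:
  fixes \<sigma> :: real and \<mu>s :: "nat \<Rightarrow> (real ^ 'n) measure" and \<mu> :: "(real ^ 'n) measure"
  assumes "\<sigma> \<ge> 0"
    and "\<And>k. \<mu>s k \<in> borel_prob_measures1"
    and "\<mu> \<in> borel_prob_measures1"
  shows "((\<lambda>k. smoothed_W1 \<sigma> (\<mu>s k) \<mu>) \<longlonglongrightarrow> 0 \<longleftrightarrow>
            (\<lambda>k. \<integral>x. norm x \<partial>\<mu>s k) \<longlonglongrightarrow> (\<integral>x. norm x \<partial>\<mu>) \<and> weakly_converges \<mu>s \<mu>)
       \<and> ((\<lambda>k. smoothed_W1 \<sigma> (\<mu>s k) \<mu>) \<longlonglongrightarrow> 0 \<longleftrightarrow> (\<lambda>k. W1 (\<mu>s k) \<mu>) \<longlonglongrightarrow> 0)"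
proof -
  note p = borel_prob_measures1D(1)
  let ?C = "(\<lambda>k. \<integral>x. norm x \<partial>\<mu>s k) \<longlonglongrightarrow> (\<integral>x. norm x \<partial>\<mu>) \<and> weakly_converges \<mu>s \<mu>"
  have *: "(\<lambda>k. smoothed_W1 s (\<mu>s k) \<mu>) \<longlonglongrightarrow> 0 \<longleftrightarrow> ?C" if s: "s \<ge> 0" for s
  proof
    assume W: "(\<lambda>k. smoothed_W1 s (\<mu>s k) \<mu>) \<longlonglongrightarrow> 0"
    show ?C
      using moments_tendsto_if_smoothed_W1[OF s assms(2,3) W]
        weakly_converges_if_smoothed_W1[OF s p[OF assms(2)] p[OF assms(3)] W] ..
  next
    assume ?C
    then have V: "(\<lambda>k. W1 (\<mu>s k) \<mu>) \<longlonglongrightarrow> 0"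
      by (elim conjE) (rule W1_tendsto_0_if_weakly_converges[OF assms(2,3)])
    show "(\<lambda>k. smoothed_W1 s (\<mu>s k) \<mu>) \<longlonglongrightarrow> 0"
    proof (rule tendsto_sandwich[OF _ _ tendsto_const V])
      show "eventually (\<lambda>k. smoothed_W1 s (\<mu>s k) \<mu> \<le> W1 (\<mu>s k) \<mu>) sequentially"
        by (intro always_eventually allI smoothed_W1_le_W1 p assms(2,3))
    qed simp
  qed
  have W1: "smoothed_W1 0 (\<mu>s k) \<mu> = W1 (\<mu>s k) \<mu>" for k
    by (intro smoothed_W1_0 p assms(2,3))
  have "(\<lambda>k. W1 (\<mu>s k) \<mu>) \<longlonglongrightarrow> 0 \<longleftrightarrow> ?C"
    using *[of 0] unfolding W1 by simp
  with *[OF assms(1)] show ?thesis by blast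
qed

end
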